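(* Let $t_0\ge 0$, let $\gamma,\delta,\sigma>0$ be constants, let $A\in\mathbb{R}^{m\times n}$, $b\in\mathbb{R}^m$, and let $f:\mathbb{R}^n\to\mathbb{R}\cup\{+\infty\}$ be proper, convex and continuously differentiable. Assume that the set $\Omega$ of saddle points of the Lagrangian $\mathcal{L}$ is nonempty, that $\nabla f$ is locally Lipschitz continuous, that $\beta:[t_0,+\infty)\to(0,+\infty)$ is continuously differentiable, and that $$\dot\beta(t)\le \frac1\delta\beta(t)\quad\text{for all } t\ge t_0,\qquad \frac1\delta<\gamma .$$ Then for any $(x_0,\lambda_0,u_0)\in\mathbb{R}^n\times\mathbb{R}^m\times\mathbb{R}^n$ there exists a unique global solution $(x(t),\lambda(t))$ with $x\in\mathcal{C}^2([t_0,+\infty),\mathbb{R}^n)$, $\lambda\in\mathcal{C}^1([t_0,+\infty),\mathbb{R}^m)$ of the dynamical system $$\begin{cases}\ddot x(t)+\gamma\dot x(t)=-\beta(t)\big(\nabla f(x(t))+A^T\lambda(t)+\sigma A^T(Ax(t)-b)\big),\\ \dot\lambda(t)=\beta(t)\big(A(x(t)+\delta\dot x(t))-b\big),\end{cases}$$ satisfying $(x(t_0),\lambda(t_0),\dot x(t_0))=(x_0,\lambda_0,u_0)$. Moreover, $(x(t),\lambda(t))$ is bounded on $[t_0,+\infty)$, and for any $(x^*,\lambda^* )\in\Omega$ the following hold: (i) $\int_{t_0}^{+\infty}\big(\frac1\delta\beta(t)-\dot\beta(t)\big)\big(\mathcal{L}^\sigma(x(t),\lambda^* )-\mathcal{L}^\sigma(x^*,\lambda(t))\big)\,dt<+\infty$.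 (ii) $\int_{t_0}^{+\infty}\beta(t)\|Ax(t)-b\|^2\,dt<+\infty$ and $\int_{t_0}^{+\infty}\|\dot x(t)\|^2\,dt<+\infty$. (iii) If $\lim_{t\to+\infty}\beta(t)=+\infty$, then, as $t\to+\infty$, $$\mathcal{L}(x(t),\lambda^* )-\mathcal{L}(x^*,\lambda(t))=\mathcal{O}\left(\frac1{\beta(t)}\right)\quad\text{and}\quad \|Ax(t)-b\|=\mathcal{O}\left(\frac1{\sqrt{\beta(t)}}\right).$$
   Context: Norms and inner products are Euclidean. Since $f$ is differentiable on $\mathbb{R}^n$, it is finite everywhere and $\nabla f$ is defined on all of $\mathbb{R}^n$. The underlying problem is $\min_x f(x)$ subject to $Ax=b$. Its Lagrangian is $\mathcal{L}(x,\lambda)=f(x)+\langle\lambda,Ax-b\rangle$ and its augmented Lagrangian is $\mathcal{L}^\sigma(x,\lambda)=\mathcal{L}(x,\lambda)+\frac\sigma2\|Ax-b\|^2$, for $(x,\lambda)\in\mathbb{R}^n\times\mathbb{R}^m$. A pair $(x^*,\lambda^* )$ is a saddle point of $\mathcal{L}$ if $\mathcal{L}(x^*,\lambda)\le\mathcal{L}(x^*,\lambda^* )\le\mathcal{L}(x,\lambda^* )$ for all $(x,\lambda)\in\mathbb{R}^n\times\mathbb{R}^m$; equivalently, $-A^T\lambda^*=\nabla f(x^* )$ and $Ax^*=b$. $\Omega$ denotes the set of saddle points of $\mathcal{L}$. *)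

theory Defs
  imports "HOL-Analysis.Analysis" "HOL-Library.Landau_Symbols"
begin

definition gradient :: "('a::real_inner \<Rightarrow> real) \<Rightarrow> 'a \<Rightarrow> 'a" where
  "gradient f x = (THE D. GDERIV f x :> D)"

definition continuously_differentiable :: "('a::real_inner \<Rightarrow> real) \<Rightarrow> bool" where
  "continuously_differentiable f \<longleftrightarrow>
     (\<forall>x. f differentiable (at x)) \<and> continuous_on UNIV (gradient f)"

definition locally_lipschitz :: "('a::metric_space \<Rightarrow> 'b::metric_space) \<Rightarrow> bool" where
  "locally_lipschitz g \<longleftrightarrow> (\<forall>x. \<exists>u>0. \<exists>L. L-lipschitz_on (cball x u) g)"

text \<open>Calculus on the half-line \<open>[t0, \<infinity>)\<close>: the derivative at the end point \<open>t0\<close> is the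
  one-sided one, and nothing depends on values to the left of \<open>t0\<close>. The library's
  \<open>C1_differentiable_on\<close> asks for two-sided derivatives, hence the separate notions.\<close>

definition deriv_from :: "real \<Rightarrow> (real \<Rightarrow> 'a::real_normed_vector) \<Rightarrow> real \<Rightarrow> 'a" where
  "deriv_from t0 x t = vector_derivative x (at t within {t0..})"

definition C1_from :: "real \<Rightarrow> (real \<Rightarrow> 'a::real_normed_vector) \<Rightarrow> bool" where
  "C1_from t0 x \<longleftrightarrow> x differentiable_on {t0..} \<and> continuous_on {t0..} (deriv_from t0 x)"

definition C2_from :: "real \<Rightarrow> (real \<Rightarrow> 'a::real_normed_vector) \<Rightarrow> bool" where
  "C2_from t0 x \<longleftrightarrow> C1_from t0 x \<and> C1_from t0 (deriv_from t0 x)"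

definition lagrangian ::
  "(real^'n \<Rightarrow> real) \<Rightarrow> real^'n^'m \<Rightarrow> real^'m \<Rightarrow> real^'n \<Rightarrow> real^'m \<Rightarrow> real" where
  "lagrangian f A b x l = f x + l \<bullet> (A *v x - b)"

definition aug_lagrangian ::
  "real \<Rightarrow> (real^'n \<Rightarrow> real) \<Rightarrow> real^'n^'m \<Rightarrow> real^'m \<Rightarrow> real^'n \<Rightarrow> real^'m \<Rightarrow> real" where
  "aug_lagrangian \<sigma> f A b x l = lagrangian f A b x l + \<sigma> / 2 * (norm (A *v x - b))\<^sup>2"

definition saddle_points ::
  "(real^'n \<Rightarrow> real) \<Rightarrow> real^'n^'m \<Rightarrow> real^'m \<Rightarrow> ((real^'n) \<times> (real^'m)) set" where
  "saddle_points f A b = {(xs, ls). \<forall>x l.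
     lagrangian f A b xs l \<le> lagrangian f A b xs ls \<and>
     lagrangian f A b xs ls \<le> lagrangian f A b x ls}"

definition global_solution ::
  "real \<Rightarrow> real \<Rightarrow> real \<Rightarrow> real \<Rightarrow> (real \<Rightarrow> real) \<Rightarrow> (real^'n \<Rightarrow> real) \<Rightarrow> real^'n^'m \<Rightarrow> real^'m
    \<Rightarrow> real^'n \<Rightarrow> real^'m \<Rightarrow> real^'n \<Rightarrow> (real \<Rightarrow> real^'n) \<Rightarrow> (real \<Rightarrow> real^'m) \<Rightarrow> bool" where
  "global_solution t0 \<gamma> \<delta> \<sigma> \<beta> f A b x0 l0 u0 x l \<longleftrightarrow>
     C2_from t0 x \<and> C1_from t0 l \<and>
     (\<forall>t\<ge>t0.
        deriv_from t0 (deriv_from t0 x) t + \<gamma> *\<^sub>R deriv_from t0 x t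
          = - (\<beta> t *\<^sub>R (gradient f (x t) + transpose A *v l t
                       + \<sigma> *\<^sub>R (transpose A *v (A *v x t - b)))) \<and>
        deriv_from t0 l t = \<beta> t *\<^sub>R (A *v (x t + \<delta> *\<^sub>R deriv_from t0 x t) - b)) \<and>
     x t0 = x0 \<and> l t0 = l0 \<and> deriv_from t0 x t0 = u0"

end

theory Submission imports Defs
begin

text \<open>Write \<open>a = 1 / \<delta>\<close> and let \<open>(xs, ls)\<close> be a saddle point, so \<open>A xs = b\<close>. Along a solution with
  \<open>u = x'\<close>, the function
  \<open>E = \<beta> (L\<^sup>\<sigma>(x, ls) - f xs) + |a (x - xs) + u|\<^sup>2 / 2 + a (\<gamma> - a) / 2 |x - xs|\<^sup>2 + a / 2 |l - ls|\<^sup>2\<close>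
  is nonnegative, and convexity of \<open>f\<close> gives
  \<open>E' \<le> - (a \<beta> - \<beta>') (L\<^sup>\<sigma>(x, ls) - f xs) - a \<beta> \<sigma> / 2 |A x - b|\<^sup>2 - (\<gamma> - a) |u|\<^sup>2 \<le> 0\<close>.
  All the estimates are read off from this inequality. Since \<open>E(t0)\<close> bounds \<open>x\<close> a priori by some
  \<open>B\<close>, one may replace \<open>\<nabla>f\<close> by \<open>\<nabla>f \<circ> P\<close>, where \<open>P\<close> is the projection onto the ball of radius
  \<open>B + 1\<close>: this makes the vector field globally Lipschitz in space, and the trajectory never
  leaves the region where the replacement is invisible.\<close>

section \<open>Calculus on a half-line and a global Picard theorem\<close>

lemma integral_has_vector_derivative_atLeast:
  fixes f :: "real \<Rightarrow> 'a::banach"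
  assumes "continuous_on {a..} f" "a \<le> t"
  shows "((\<lambda>u. integral {a..u} f) has_vector_derivative f t) (at t within {a..})"
proof -
  \<comment> \<open>Differentiation is local; the \<open>+ 1\<close> keeps \<open>t\<close> away
    from the right end of the compact interval, so the two filters agree.\<close>
  have "at t within {a..} = at t within {a..t + 1}"
    by (rule at_within_nhd[of t "{..<t + 1}"]) auto
  moreover have "continuous_on {a..t + 1} f"
    by (rule continuous_on_subset[OF assms(1)]) auto
  ultimately show ?thesis
    using integral_has_vector_derivative[of a "t + 1" f t] assms(2) by simp
qed

lemma has_integral_derivative_atLeast:
  fixes f :: "real \<Rightarrow> 'a::banach"
  assumes "\<And>t. a \<le> t \<Longrightarrow> (f has_vector_derivative f' t) (at t within {a..})" "a \<le> t"
  shows "(f' has_integral f t - f a) {a..t}"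
  by (rule fundamental_theorem_of_calculus[OF assms(2)])
    (auto intro: has_vector_derivative_within_subset[OF assms(1)])

lemma continuous_on_derivative_atLeast:
  assumes "\<And>t. a \<le> t \<Longrightarrow> (f has_vector_derivative f' t) (at t within {a..})"
  shows "continuous_on {a..} f"
  by (rule continuous_on_vector_derivative[of _ f f']) (auto intro: assms)

text \<open>Picard iteration for the unknown divided by a weight \<open>w\<close>, in the Banach
  space of bounded continuous functions. The one rate \<open>\<kappa>\<close> controls both the
  Lipschitz constant and the size at \<open>0\<close>: the former gives the contraction, the latter
  makes the operator map into bounded functions. Uniqueness is stated for the solutions that visibly
  lie in this space.\<close>

lemma ivp_linear_growth:
  fixes F :: "real \<Rightarrow> 'a::banach \<Rightarrow> 'a"
  assumes contF: "continuous_on ({a..} \<times> UNIV) (\<lambda>(t, z). F t z)"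
    and cont\<kappa>: "continuous_on {a..} \<kappa>"
    and lip: "\<And>t y z. a \<le> t \<Longrightarrow> norm (F t y - F t z) \<le> \<kappa> t * norm (y - z)"
    and F0: "\<And>t. a \<le> t \<Longrightarrow> norm (F t 0) \<le> \<kappa> t"
  shows "\<exists>z. z a = z0 \<and>
    (\<forall>t\<ge>a. (z has_vector_derivative F t (z t)) (at t within {a..})) \<and>
    (\<forall>y. y a = z0 \<longrightarrow> bounded (y ` {a..}) \<longrightarrow>
       (\<forall>t\<ge>a. (y has_vector_derivative F t (y t)) (at t within {a..})) \<longrightarrow>
       (\<forall>t\<ge>a. y t = z t))"
proof -
  \<comment> \<open>Measured relative to this weight, the Picard operator is a contraction with factor
    \<open>1 / 2\<close> on the whole half-line, so no continuation argument is needed.\<close>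
  define w where "w t = exp (2 * integral {a..t} \<kappa>)" for t
  have \<kappa>0: "0 \<le> \<kappa> t" if "a \<le> t" for t
    using F0[OF that] norm_ge_zero order_trans by blast
  have wa: "w a = 1" by (simp add: w_def)
  have dw: "(w has_vector_derivative 2 * (\<kappa> t * w t)) (at t within {a..})" if "a \<le> t" for t
  proof -
    have "((\<lambda>u. integral {a..u} \<kappa>) has_field_derivative \<kappa> t) (at t within {a..})"
      using integral_has_vector_derivative_atLeast[OF cont\<kappa> that]
      by (simp add: has_real_derivative_iff_has_vector_derivative)
    then have "(w has_field_derivative 2 * (\<kappa> t * w t)) (at t within {a..})"
      unfolding w_def by (auto intro!: derivative_eq_intros)
    then show ?thesis
      by (simp add: has_real_derivative_iff_has_vector_derivative)
  qed
  have contw: "continuous_on {a..} w"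
    by (rule continuous_on_derivative_atLeast[OF dw])
  have w_pos: "0 < w t" for t by (simp add: w_def)
  have scale: "norm (p /\<^sub>R w t) \<le> d \<longleftrightarrow> norm p \<le> d * w t" for p :: 'a and t d
    using w_pos[of t] by (simp add: field_simps)
  have int_\<kappa>w: "((\<lambda>t. \<kappa> t * w t) has_integral (w t - 1) / 2) {a..t}" if "a \<le> t" for t
  proof -
    have "((\<lambda>t. 2 * (\<kappa> t * w t)) has_integral w t - w a) {a..t}"
      by (rule has_integral_derivative_atLeast[OF dw that])
    from has_integral_mult_right[OF this, of "1/2"] show ?thesis
      by (simp add: wa)
  qed
  have w1: "1 \<le> w t" if "a \<le> t" for t
  proof -
    have "0 \<le> (w t - 1) / 2"
      by (rule has_integral_nonneg[OF int_\<kappa>w[OF that]]) (simp add: \<kappa>0 less_imp_le[OF w_pos])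
    then show ?thesis by simp
  qed
  \<comment> \<open>Since \<open>w' = 2 \<kappa> w\<close>, integrating \<open>\<kappa> w\<close>
    costs a factor \<open>1 / 2\<close>. This is the source of both the self-map bound and the
    contraction constant.\<close>
  have key: "norm (integral {a..t} h) \<le> c / 2 * w t"
    if "a \<le> t" "continuous_on {a..} h" "0 \<le> c" "\<And>s. a \<le> s \<Longrightarrow> norm (h s) \<le> c * (\<kappa> s * w s)"
    for c t and h :: "real \<Rightarrow> 'a"
  proof -
    have "norm (integral {a..t} h) \<le> integral {a..t} (\<lambda>s. c * (\<kappa> s * w s))"
      using that int_\<kappa>w[OF that(1)]
      by (intro integral_norm_bound_integral integrable_continuous_real
          continuous_on_subset[OF that(2)] continuous_on_mult_left continuous_on_mult
          continuous_on_subset[OF cont\<kappa>] continuous_on_subset[OF contw])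
        (auto intro!: has_integral_integrable has_integral_mult_right)
    also have "\<dots> = c * ((w t - 1) / 2)"
      using has_integral_mult_right[OF int_\<kappa>w[OF that(1)], of c] by (rule integral_unique)
    also have "\<dots> \<le> c / 2 * w t"
      using that(3) by (simp add: algebra_simps)
    finally show ?thesis .
  qed
  have contG: "continuous_on {a..} (\<lambda>s. F s (y s))" if "continuous_on {a..} y" for y
  proof -
    have "continuous_on {a..} (\<lambda>s. (\<lambda>(t, z). F t z) (s, y s))"
      by (rule continuous_on_compose2[OF contF]) (auto intro!: continuous_intros that)
    then show ?thesis by simp
  qed
  \<comment> \<open>The Picard operator conjugated by the weight: \<open>v\<close> stands for a
    candidate solution divided by \<open>w\<close>.\<close>
  define \<Phi> where "\<Phi> v t = (z0 + integral {a..t} (\<lambda>s. F s (w s *\<^sub>R apply_bcontfun v s))) /\<^sub>R w t"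
    for v :: "real \<Rightarrow>\<^sub>C 'a" and t
  have contv: "continuous_on {a..} (\<lambda>s. F s (w s *\<^sub>R apply_bcontfun v s))" for v
    by (intro contG continuous_intros contw) simp
  have dI: "((\<lambda>t. z0 + integral {a..t} (\<lambda>s. F s (w s *\<^sub>R apply_bcontfun v s)))
      has_vector_derivative F t (w t *\<^sub>R apply_bcontfun v t)) (at t within {a..})"
    if "a \<le> t" for v t
    using has_vector_derivative_add[OF has_vector_derivative_const
        integral_has_vector_derivative_atLeast[OF contv that]]
    by simp
  have cont\<Phi>: "continuous_on {a..} (\<Phi> v)" for v
    unfolding \<Phi>_def
    using continuous_on_derivative_atLeast[OF dI[of _ v]] contw w_pos less_imp_neq[OF w_pos]
    by (intro continuous_on_scaleR continuous_on_inverse) (auto simp: w_def)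
  \<comment> \<open>The growth bound \<open>|F s z| \<le> \<kappa> s (|z| + 1)\<close> is applied at
    \<open>z = w v\<close>; \<open>1 \<le> w\<close> absorbs the constant into the weight.\<close>
  have bound\<Phi>: "norm (\<Phi> v t) \<le> norm z0 + (1 + norm v) / 2" if "a \<le> t" for v t
  proof -
    have "norm (integral {a..t} (\<lambda>s. F s (w s *\<^sub>R apply_bcontfun v s))) \<le> (1 + norm v) / 2 * w t"
    proof (rule key[OF that contv])
      fix s assume s: "a \<le> s"
      have "norm (F s (w s *\<^sub>R apply_bcontfun v s))
          \<le> norm (F s (w s *\<^sub>R apply_bcontfun v s) - F s 0) + norm (F s 0)"
        by (metis add.commute norm_triangle_sub)
      also have "\<dots> \<le> \<kappa> s * (w s * norm v) + \<kappa> s * w s"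
      proof (rule add_mono)
        have "norm (F s (w s *\<^sub>R apply_bcontfun v s) - F s 0) \<le> \<kappa> s * (w s * norm (apply_bcontfun v s))"
          using lip[OF s, of "w s *\<^sub>R apply_bcontfun v s" 0] w_pos[of s] by simp
        also have "\<dots> \<le> \<kappa> s * (w s * norm v)"
          using \<kappa>0[OF s] w_pos[of s] norm_bounded[of v s] by (intro mult_left_mono) auto
        finally show "norm (F s (w s *\<^sub>R apply_bcontfun v s) - F s 0) \<le> \<kappa> s * (w s * norm v)" .
        show "norm (F s 0) \<le> \<kappa> s * w s"
          using F0[OF s] mult_left_mono[OF w1[OF s] \<kappa>0[OF s]] by simp
      qed
      finally show "norm (F s (w s *\<^sub>R apply_bcontfun v s)) \<le> (1 + norm v) * (\<kappa> s * w s)"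
        by (simp add: algebra_simps)
    qed simp
    moreover have "norm z0 \<le> norm z0 * w t"
      using mult_left_mono[OF w1[OF that], of "norm z0"] by simp
    ultimately have "norm (z0 + integral {a..t} (\<lambda>s. F s (w s *\<^sub>R apply_bcontfun v s)))
        \<le> (norm z0 + (1 + norm v) / 2) * w t"
      using norm_triangle_ineq[of z0 "integral {a..t} (\<lambda>s. F s (w s *\<^sub>R apply_bcontfun v s))"]
      unfolding distrib_right by linarith
    then show ?thesis
      unfolding \<Phi>_def scale .
  qed
  have ext: "(\<lambda>t. h (max a t)) \<in> bcontfun"
    if "continuous_on {a..} h" "\<And>t. a \<le> t \<Longrightarrow> norm (h t) \<le> c" for h :: "real \<Rightarrow> 'a" and c
  proof -
    have "continuous_on UNIV (\<lambda>t. h (max a t))"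
      by (rule continuous_on_compose2[OF that(1)]) (auto intro!: continuous_intros)
    moreover have "bounded (range (\<lambda>t. h (max a t)))"
      by (rule boundedI[of _ c]) (auto intro!: that(2))
    ultimately show ?thesis by (simp add: bcontfun_def)
  qed
  \<comment> \<open>The \<open>max\<close> extends functions to the left of \<open>a\<close> because \<open>\<Rightarrow>\<^sub>C\<close> has the whole line as domain.\<close>
  define T where "T v = Bcontfun (\<lambda>t. \<Phi> v (max a t))" for v
  have T: "apply_bcontfun (T v) t = \<Phi> v (max a t)" for v t
    unfolding T_def using Bcontfun_inverse[OF ext[OF cont\<Phi> bound\<Phi>]] by simp
  have "\<exists>!v. T v = v"
  proof (rule banach_fix_type[of "1/2"], simp, simp, intro allI dist_bound)
    fix u v :: "real \<Rightarrow>\<^sub>C 'a" and t' :: real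
    define t where "t = max a t'"
    have t: "a \<le> t" by (simp add: t_def)
    let ?h = "\<lambda>v s. F s (w s *\<^sub>R apply_bcontfun v s)"
    have "norm (integral {a..t} (\<lambda>s. ?h u s - ?h v s)) \<le> dist u v / 2 * w t"
    proof (rule key[OF t])
      show "continuous_on {a..} (\<lambda>s. ?h u s - ?h v s)"
        by (intro continuous_intros contv)
      fix s assume s: "a \<le> s"
      have "norm (?h u s - ?h v s) \<le> \<kappa> s * norm (w s *\<^sub>R apply_bcontfun u s - w s *\<^sub>R apply_bcontfun v s)"
        by (rule lip[OF s])
      also have "\<dots> = \<kappa> s * (w s * dist (apply_bcontfun u s) (apply_bcontfun v s))"
        using w_pos[of s] by (simp add: dist_norm flip: scaleR_diff_right)
      also have "\<dots> \<le> \<kappa> s * (w s * dist u v)"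
        using \<kappa>0[OF s] w_pos[of s] dist_bounded[of u s v] by (intro mult_left_mono) auto
      finally show "norm (?h u s - ?h v s) \<le> dist u v * (\<kappa> s * w s)"
        by (simp add: mult_ac)
    qed simp
    moreover have "integral {a..t} (\<lambda>s. ?h u s - ?h v s) = integral {a..t} (?h u) - integral {a..t} (?h v)"
      by (intro integral_diff integrable_continuous_real continuous_on_subset[OF contv]) auto
    moreover have "\<Phi> u t - \<Phi> v t = (integral {a..t} (?h u) - integral {a..t} (?h v)) /\<^sub>R w t"
      by (simp add: \<Phi>_def flip: scaleR_diff_right)
    ultimately have "norm (\<Phi> u t - \<Phi> v t) \<le> dist u v / 2"
      by (simp only: scale)
    then show "dist (apply_bcontfun (T u) t') (apply_bcontfun (T v) t') \<le> 1 / 2 * dist u v"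
      by (simp add: T dist_norm t_def)
  qed
  then obtain v where v: "T v = v" and v_unique: "\<And>u. T u = u \<Longrightarrow> u = v" by auto
  define z where "z t = w t *\<^sub>R apply_bcontfun v t" for t
  have z: "z t = z0 + integral {a..t} (\<lambda>s. F s (z s))" if "a \<le> t" for t
    using T[of v t] v that w_pos[of t] by (simp add: z_def \<Phi>_def)
  show ?thesis
  proof (intro exI[of _ z] conjI allI impI)
    show "z a = z0" using z[of a] by simp
    show "(z has_vector_derivative F t (z t)) (at t within {a..})" if "a \<le> t" for t
      using dI[OF that, of v] that z
      by (intro has_vector_derivative_transform[OF _ z]) (auto simp: z_def)
  next
    fix y t
    assume ya: "y a = z0" and bdd: "bounded (y ` {a..})" and t: "a \<le> t"
      and "\<forall>t\<ge>a. (y has_vector_derivative F t (y t)) (at t within {a..})"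
    then have dy: "(y has_vector_derivative F t (y t)) (at t within {a..})" if "a \<le> t" for t
      using that by blast
    obtain c where c: "\<And>t. a \<le> t \<Longrightarrow> norm (y t) \<le> c"
      using bdd by (force simp: bounded_iff)
    have conty: "continuous_on {a..} y" by (rule continuous_on_derivative_atLeast[OF dy])
    \<comment> \<open>Because \<open>1 \<le> w\<close>, a bounded solution stays bounded after
      division by \<open>w\<close>. Its integral equation then says that the quotient is a fixed
      point of \<open>T\<close>, hence equals \<open>v\<close>.\<close>
    define u where "u = Bcontfun (\<lambda>t. y (max a t) /\<^sub>R w (max a t))"
    have y1: "norm (y t /\<^sub>R w t) \<le> c" if "a \<le> t" for t
    proof -
      have "norm (y t) \<le> c * w t"
        using c[OF that] w1[OF that] norm_ge_zero[of "y t"]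
        by (smt (verit) mult_left_mono mult_cancel_left2)
      then show ?thesis unfolding scale .
    qed
    have "continuous_on {a..} (\<lambda>t. y t /\<^sub>R w t)"
      using w_pos less_imp_neq[OF w_pos] by (intro continuous_intros conty contw) (auto simp: w_def)
    then have "(\<lambda>t. y (max a t) /\<^sub>R w (max a t)) \<in> bcontfun"
      using y1 by (rule ext)
    then have u: "apply_bcontfun u t = y (max a t) /\<^sub>R w (max a t)" for t
      unfolding u_def by (simp add: Bcontfun_inverse)
    have wu: "w s *\<^sub>R apply_bcontfun u s = y s" if "a \<le> s" for s
      using that w_pos[of s] by (simp add: u)
    have "T u = u"
    proof (rule bcontfun_eqI)
      fix t'
      define t where "t = max a t'"
      have t: "a \<le> t" by (simp add: t_def)
      have "integral {a..t} (\<lambda>s. F s (w s *\<^sub>R apply_bcontfun u s)) = integral {a..t} (\<lambda>s. F s (y s))"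
        by (intro integral_cong) (simp add: wu)
      also have "\<dots> = y t - y a"
        by (rule integral_unique[OF has_integral_derivative_atLeast[OF dy t]])
      finally have "\<Phi> u t = y t /\<^sub>R w t"
        by (simp add: \<Phi>_def ya)
      then show "apply_bcontfun (T u) t' = apply_bcontfun u t'"
        by (simp add: T u t_def)
    qed
    then have "u = v" by (rule v_unique)
    then show "y t = z t" using wu[OF t] by (simp add: z_def)
  qed
qed

section \<open>Gradients, convexity and saddle points\<close>

lemma GDERIV_unique:
  assumes "GDERIV f x :> D" "GDERIV f x :> E"
  shows "D = E"
proof -
  have "(\<lambda>h. h \<bullet> D) = (\<lambda>h. h \<bullet> E)"
    using has_derivative_unique assms unfolding gderiv_def by blast
  then have "h \<bullet> D = h \<bullet> E" for h by metis
  then show ?thesis by (metis vector_eq_ldot inner_commute)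
qed

text \<open>Riesz representation in finite dimension: the derivative is the inner product with the
  vector of its values on \<open>Basis\<close>, and uniqueness lets the definite description select
  that vector.\<close>

lemma GDERIV_gradient:
  fixes f :: "'a::euclidean_space \<Rightarrow> real"
  assumes "f differentiable (at x)"
  shows "GDERIV f x :> gradient f x"
proof -
  obtain f' where f': "(f has_derivative f') (at x)"
    using assms by (auto simp: differentiable_def)
  interpret bounded_linear f' by (rule has_derivative_bounded_linear[OF f'])
  have "f' h = h \<bullet> (\<Sum>i\<in>Basis. f' i *\<^sub>R i)" for h
  proof -
    have "f' h = f' (\<Sum>i\<in>Basis. (h \<bullet> i) *\<^sub>R i)" by (simp add: euclidean_representation)
    also have "\<dots> = h \<bullet> (\<Sum>i\<in>Basis. f' i *\<^sub>R i)"
      unfolding sum scaleR inner_sum_right inner_scaleR_right by (simp add: mult.commute)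
    finally show ?thesis .
  qed
  then have "f' = (\<lambda>h. h \<bullet> (\<Sum>i\<in>Basis. f' i *\<^sub>R i))" by (rule ext)
  with f' have *: "GDERIV f x :> (\<Sum>i\<in>Basis. f' i *\<^sub>R i)"
    unfolding gderiv_def by (rule back_subst)
  show ?thesis
    unfolding gradient_def by (rule theI[where P = "\<lambda>D. GDERIV f x :> D", OF *]) (rule GDERIV_unique[OF _ *])
qed

text \<open>Restriction to the line through \<open>x\<close> and \<open>y\<close> reduces this to
  the tangent inequality for a convex function of one real variable.\<close>

lemma convex_on_imp_above_gradient:
  fixes f :: "'a::real_inner \<Rightarrow> real"
  assumes "convex_on UNIV f" "GDERIV f x :> g"
  shows "f y - f x \<ge> (y - x) \<bullet> g"
proof -
  let ?p = "\<lambda>s. x + s *\<^sub>R (y - x)"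
  have "convex_on UNIV (\<lambda>s. f (?p s))"
  proof (rule convex_onI)
    fix t s r :: real
    assume t: "0 < t" "t < 1"
    have "?p ((1 - t) *\<^sub>R s + t *\<^sub>R r) = (1 - t) *\<^sub>R ?p s + t *\<^sub>R ?p r"
      by (simp add: algebra_simps)
    then show "f (?p ((1 - t) *\<^sub>R s + t *\<^sub>R r)) \<le> (1 - t) * f (?p s) + t * f (?p r)"
      using convex_onD[OF assms(1), of t "?p s" "?p r"] t by simp
  qed simp
  moreover have "((\<lambda>s. f (?p s)) has_field_derivative (y - x) \<bullet> g) (at 0)"
  proof -
    have "(?p has_derivative (\<lambda>s. s *\<^sub>R (y - x))) (at 0)"
      by (auto intro!: derivative_eq_intros)
    moreover have "(f has_derivative (\<lambda>h. h \<bullet> g)) (at (?p 0))"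
      using assms(2) by (simp add: gderiv_def)
    ultimately have "((\<lambda>s. f (?p s)) has_derivative (\<lambda>s. (s *\<^sub>R (y - x)) \<bullet> g)) (at 0)"
      by (rule has_derivative_compose)
    then show ?thesis
      by (simp add: has_field_derivative_def mult_commute_abs)
  qed
  ultimately show ?thesis
    using convex_on_imp_above_tangent[of UNIV "\<lambda>s. f (?p s)" 0 1 "(y - x) \<bullet> g"] by simp
qed

lemma locally_lipschitz_imp_lipschitz_on_compact:
  assumes "locally_lipschitz g" "compact X"
  obtains L where "L-lipschitz_on X g"
proof -
  \<comment> \<open>The notion for time-dependent maps is used with a constant family over a single
    time.\<close>
  have "local_lipschitz {0::real} X (\<lambda>_. g)"
    using assms(1) unfolding local_lipschitz_def locally_lipschitz_def
    by (meson Int_lower1 lipschitz_on_subset)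
  then show thesis
    using local_lipschitz_compact_implies_lipschitz[where X = X and T = "{0::real}" and f = "\<lambda>_. g"] assms(2) that
    by (auto intro: continuous_intros)
qed

lemma inner_transpose_mult:
  fixes A :: "real^'n^'m"
  shows "(transpose A *v y) \<bullet> x = y \<bullet> (A *v x)" "x \<bullet> (transpose A *v y) = (A *v x) \<bullet> y"
  by (simp_all add: dot_lmul_matrix inner_commute[of x "y v* A"] inner_commute[of "A *v x"])

text \<open>The Lagrangian is affine in the multiplier, with the residual as slope. Moving
  \<open>ls\<close> by the residual raises it by the squared residual, which maximality in the
  multiplier forbids unless the residual is zero.\<close>

lemma saddle_points_feasible:
  assumes "(xs, ls) \<in> saddle_points f A b"
  shows "A *v xs = b"
proof -
  have "lagrangian f A b xs (ls + (A *v xs - b)) \<le> lagrangian f A b xs ls"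
    using assms by (auto simp: saddle_points_def)
  then have "(A *v xs - b) \<bullet> (A *v xs - b) \<le> 0"
    by (simp add: lagrangian_def inner_add_left)
  then have "(A *v xs - b) \<bullet> (A *v xs - b) = 0"
    by (intro antisym inner_ge_zero)
  then show ?thesis by simp
qed

lemma saddle_points_minimizer:
  assumes "(xs, ls) \<in> saddle_points f A b"
  shows "f xs \<le> lagrangian f A b x ls"
  using assms saddle_points_feasible[OF assms]
  by (auto simp: saddle_points_def lagrangian_def)

section \<open>The Lyapunov function\<close>

lemma has_vector_derivative_norm_power2:
  assumes "(y has_vector_derivative y') (at t within S)"
  shows "((\<lambda>t. (norm (y t))\<^sup>2) has_vector_derivative 2 * (y' \<bullet> y t)) (at t within S)"
  using bounded_bilinear.has_vector_derivative[OF bounded_bilinear_inner assms assms]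
  by (simp add: power2_norm_eq_inner inner_commute)

lemma GDERIV_compose_vector_derivative:
  assumes "GDERIV f (y t) :> g" "(y has_vector_derivative y') (at t within S)"
  shows "((\<lambda>t. f (y t)) has_vector_derivative y' \<bullet> g) (at t within S)"
  using has_derivative_compose[OF assms(2)[unfolded has_vector_derivative_def]
      assms(1)[unfolded gderiv_def]]
  by (simp add: has_vector_derivative_def)

text \<open>A function of a state rather than of a trajectory, so that lower bounds and sublevel
  sets can be discussed without time; \<open>c\<close> stands for the value of
  \<open>\<beta>\<close> and \<open>u\<close> for the velocity.\<close>

definition lyapunov ::
  "real \<Rightarrow> real \<Rightarrow> real \<Rightarrow> (real^'n \<Rightarrow> real) \<Rightarrow> real^'n^'m \<Rightarrow> real^'m \<Rightarrow> real^'n \<Rightarrow> real^'m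
    \<Rightarrow> real \<Rightarrow> real^'n \<Rightarrow> real^'m \<Rightarrow> real^'n \<Rightarrow> real" where
  "lyapunov a \<gamma> \<sigma> f A b xs ls c x l u =
     c * (aug_lagrangian \<sigma> f A b x ls - f xs) + (norm (a *\<^sub>R (x - xs) + u))\<^sup>2 / 2
     + a * (\<gamma> - a) / 2 * (norm (x - xs))\<^sup>2 + a / 2 * (norm (l - ls))\<^sup>2"

text \<open>An exact identity resting on three cancellations, with \<open>p = x - xs\<close>. The
  derivative of the gap cancels the force tested against \<open>u\<close>. The term in
  \<open>|p|^2\<close> cancels the product of \<open>p\<close> and \<open>u\<close> left by damping.
  The multiplier term cancels \<open>A\<close> applied to \<open>a p + u\<close> paired with
  \<open>l - ls\<close>, precisely because the extrapolation step in the equation for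
  \<open>l\<close> is \<open>1 / a\<close>.\<close>

lemma lyapunov_has_derivative:
  fixes A :: "real^'n^'m"
  assumes df: "GDERIV f (x t) :> g"
    and dx: "(x has_vector_derivative u t) (at t within S)"
    and du: "(u has_vector_derivative - (\<beta> t *\<^sub>R (g + transpose A *v l t
      + \<sigma> *\<^sub>R (transpose A *v (A *v x t - b)))) - \<gamma> *\<^sub>R u t) (at t within S)"
    and dl: "(l has_vector_derivative \<beta> t *\<^sub>R (A *v (x t + (1 / a) *\<^sub>R u t) - b)) (at t within S)"
    and d\<beta>: "(\<beta> has_vector_derivative \<beta>') (at t within S)"
    and "A *v xs = b" and "a \<noteq> 0"
  shows "((\<lambda>t. lyapunov a \<gamma> \<sigma> f A b xs ls (\<beta> t) (x t) (l t) (u t)) has_vector_derivative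
      \<beta>' * (aug_lagrangian \<sigma> f A b (x t) ls - f xs)
      - a * \<beta> t * ((x t - xs) \<bullet> (g + transpose A *v ls + \<sigma> *\<^sub>R (transpose A *v (A *v x t - b))))
      - (\<gamma> - a) * (norm (u t))\<^sup>2) (at t within S)"
proof -
  have dAx: "((\<lambda>t. A *v x t - b) has_vector_derivative A *v u t) (at t within S)"
    using has_vector_derivative_diff[OF bounded_linear.has_vector_derivative[OF
          matrix_vector_mul_bounded_linear dx] has_vector_derivative_const] by simp
  have dls: "((\<lambda>t. ls \<bullet> (A *v x t - b)) has_vector_derivative ls \<bullet> (A *v u t)) (at t within S)"
    by (rule bounded_linear.has_vector_derivative[OF bounded_linear_inner_right dAx])
  have dW: "((\<lambda>t. aug_lagrangian \<sigma> f A b (x t) ls - f xs) has_vector_derivative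
      u t \<bullet> (g + transpose A *v ls + \<sigma> *\<^sub>R (transpose A *v (A *v x t - b)))) (at t within S)"
    unfolding aug_lagrangian_def lagrangian_def
    by (rule has_vector_derivative_eq_rhs[OF has_vector_derivative_diff[OF
          has_vector_derivative_add[OF has_vector_derivative_add[OF
              GDERIV_compose_vector_derivative[where f = f, OF df dx] dls]
            has_vector_derivative_mult_right[OF has_vector_derivative_norm_power2[OF dAx], of "\<sigma> / 2"]]
          has_vector_derivative_const]])
      (simp add: inner_transpose_mult inner_add_right inner_commute del: transpose_matrix_vector)
  have dxs: "((\<lambda>t. x t - xs) has_vector_derivative u t) (at t within S)"
    using has_vector_derivative_diff[OF dx has_vector_derivative_const] by simp
  have dls': "((\<lambda>t. l t - ls) has_vector_derivative \<beta> t *\<^sub>R (A *v (x t + (1 / a) *\<^sub>R u t) - b)) (at t within S)"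
    using has_vector_derivative_diff[OF dl has_vector_derivative_const] by simp
  have dv: "((\<lambda>t. a *\<^sub>R (x t - xs) + u t) has_vector_derivative
     a *\<^sub>R u t + (- (\<beta> t *\<^sub>R (g + transpose A *v l t
      + \<sigma> *\<^sub>R (transpose A *v (A *v x t - b)))) - \<gamma> *\<^sub>R u t)) (at t within S)"
    by (intro has_vector_derivative_add du
        bounded_linear.has_vector_derivative[OF bounded_linear_scaleR_right dxs])
  define p where "p = x t - xs"
  have Ap: "A *v x t - b = A *v p"
    using assms(6) by (simp add: p_def matrix_vector_mult_diff_distrib)
  have Au: "A *v (x t + (1 / a) *\<^sub>R u t) - b = A *v p + (1 / a) *\<^sub>R (A *v u t)"
    using Ap by (simp add: matrix_vector_right_distrib matrix_vector_mult_scaleR)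
  note dE = has_vector_derivative_add[OF has_vector_derivative_add[OF has_vector_derivative_add[OF
        has_vector_derivative_mult[OF d\<beta> dW]
        has_vector_derivative_divide[OF has_vector_derivative_norm_power2[OF dv], of 2]]
        has_vector_derivative_mult_right[OF has_vector_derivative_norm_power2[OF dxs], of "a * (\<gamma> - a) / 2"]]
        has_vector_derivative_mult_right[OF has_vector_derivative_norm_power2[OF dls'], of "a / 2"]]
  show ?thesis
    unfolding lyapunov_def
    apply (rule has_vector_derivative_eq_rhs[OF dE])
    unfolding Au Ap p_def[symmetric]
    using \<open>a \<noteq> 0\<close>
    apply (simp add: inner_transpose_mult power2_norm_eq_inner inner_simps inner_commute algebra_simps
        del: transpose_matrix_vector)
    apply (simp only: add_divide_distrib diff_divide_distrib)
    done
qed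

text \<open>All four summands are nonnegative, the first by the saddle property, so each is at most
  their sum.\<close>

lemma lyapunov_lower_bounds:
  fixes A :: "real^'n^'m" and x u :: "real^'n" and l :: "real^'m"
  assumes "(xs, ls) \<in> saddle_points f A b" "0 < a" "a < \<gamma>" "0 \<le> \<sigma>" "0 \<le> c"
  defines "E \<equiv> lyapunov a \<gamma> \<sigma> f A b xs ls c x l u"
  shows "c * (aug_lagrangian \<sigma> f A b x ls - f xs) \<le> E"
    "(norm (a *\<^sub>R (x - xs) + u))\<^sup>2 / 2 \<le> E"
    "a * (\<gamma> - a) / 2 * (norm (x - xs))\<^sup>2 \<le> E"
    "a / 2 * (norm (l - ls))\<^sup>2 \<le> E"
    "0 \<le> E"
proof -
  have "0 \<le> c * (aug_lagrangian \<sigma> f A b x ls - f xs)"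
    using saddle_points_minimizer[OF assms(1), of x] assms
    by (auto intro!: mult_nonneg_nonneg add_increasing2 simp: aug_lagrangian_def)
  moreover have "0 \<le> (norm (a *\<^sub>R (x - xs) + u))\<^sup>2 / 2" "0 \<le> a * (\<gamma> - a) / 2 * (norm (x - xs))\<^sup>2"
     "0 \<le> a / 2 * (norm (l - ls))\<^sup>2"
    using assms by auto
  ultimately show "c * (aug_lagrangian \<sigma> f A b x ls - f xs) \<le> E"
    "(norm (a *\<^sub>R (x - xs) + u))\<^sup>2 / 2 \<le> E"
    "a * (\<gamma> - a) / 2 * (norm (x - xs))\<^sup>2 \<le> E"
    "a / 2 * (norm (l - ls))\<^sup>2 \<le> E"
    "0 \<le> E"
    unfolding E_def lyapunov_def by linarith+
qed

text \<open>The tangent inequality handles \<open>f\<close>. The penalty contributes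
  \<open>\<sigma> |A x - b|^2\<close> to the inner product but only half of that to the gap; the
  surplus half later makes the residual integrable.\<close>

lemma aug_lagrangian_gap_gradient:
  fixes A :: "real^'n^'m"
  assumes "convex_on UNIV f" "GDERIV f x :> g" "A *v xs = b"
  shows "aug_lagrangian \<sigma> f A b x ls - f xs + \<sigma> / 2 * (norm (A *v x - b))\<^sup>2
    \<le> (x - xs) \<bullet> (g + transpose A *v ls + \<sigma> *\<^sub>R (transpose A *v (A *v x - b)))"
proof -
  have "A *v x - b = A *v (x - xs)"
    using assms(3) by (simp add: matrix_vector_mult_diff_distrib)
  moreover have "f x - f xs \<le> (x - xs) \<bullet> g"
    using convex_on_imp_above_gradient[OF assms(1,2), of xs] by (simp add: inner_diff_left)
  ultimately show ?thesis
    by (simp add: aug_lagrangian_def lagrangian_def inner_transpose_mult inner_add_right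
        power2_norm_eq_inner inner_commute del: transpose_matrix_vector)
qed

section \<open>Integrability from dissipation, and a barrier principle\<close>

text \<open>Monotone convergence along the truncations to \<open>{a..a + n}\<close>; at each fixed
  \<open>t\<close> the truncated values are eventually constant in \<open>n\<close>.\<close>

lemma set_integrable_atLeast_bounded_integral:
  fixes h :: "real \<Rightarrow> real"
  assumes cont: "continuous_on {a..} h" and nonneg: "\<And>t. a \<le> t \<Longrightarrow> 0 \<le> h t"
    and bound: "\<And>t. a \<le> t \<Longrightarrow> integral {a..t} h \<le> C"
  shows "set_integrable lborel {a..} h"
proof -
  let ?h = "\<lambda>n t. indicator {a..a + real n} t *\<^sub>R h t"
  have int: "set_integrable lborel {a..t} h" for t
    by (intro borel_integrable_atLeastAtMost' continuous_on_subset[OF cont]) auto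
  have mono: "mono (\<lambda>n. ?h n t)" for t
    using nonneg by (auto simp: mono_def indicator_def)
  have eq: "(LINT t|lborel. ?h n t) = integral {a..a + real n} h" for n
    using set_borel_integral_eq_integral(2)[OF int] by (simp add: set_lebesgue_integral_def)
  have "incseq (\<lambda>n. LINT t|lborel. ?h n t)"
    using int monoD[OF mono] unfolding incseq_def set_integrable_def
    by (intro allI impI integral_mono) blast+
  moreover have "\<forall>n. (LINT t|lborel. ?h n t) \<le> C"
    unfolding eq using bound by simp
  ultimately obtain L where L: "(\<lambda>n. LINT t|lborel. ?h n t) \<longlonglongrightarrow> L"
    using incseq_convergent by blast
  have lim: "(\<lambda>n. ?h n t) \<longlonglongrightarrow> indicator {a..} t *\<^sub>R h t" for t
  proof (rule tendsto_eventually)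
    obtain N :: nat where "t - a \<le> N" using real_arch_simple by blast
    then show "\<forall>\<^sub>F n in sequentially. ?h n t = indicator {a..} t *\<^sub>R h t"
      by (intro eventually_sequentiallyI[of N]) (auto simp: indicator_def)
  qed
  have meas: "(\<lambda>t. indicator {a..} t *\<^sub>R h t) \<in> borel_measurable lborel"
    using borel_measurable_continuous_on_indicator[OF _ cont] by simp
  have int': "integrable lborel (?h n)" for n
    using int unfolding set_integrable_def .
  have nn: "0 \<le> ?h n t" for n t
    using nonneg by (simp add: indicator_def)
  show ?thesis
    unfolding set_integrable_def
  proof (rule integral_monotone_convergence_nonneg(1))
    show "integrable lborel (?h n)" for n by (rule int')
    show "AE t in lborel. mono (\<lambda>n. ?h n t)" using mono by (rule AE_I2)
    show "AE t in lborel. 0 \<le> ?h n t" for n using nn by (rule AE_I2)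
    show "AE t in lborel. (\<lambda>n. ?h n t) \<longlonglongrightarrow> indicator {a..} t *\<^sub>R h t" using lim by (rule AE_I2)
  qed (rule L meas)+
qed

text \<open>Integrating the inequality for \<open>E'\<close> and discarding
  \<open>E t \<ge> 0\<close> bounds every partial integral of \<open>h\<close> by
  \<open>E a / k\<close>. The gauge integral integrates any derivative, so \<open>E'\<close> may be
  a pointwise choice of derivatives.\<close>

lemma set_integrable_dissipation:
  fixes E h :: "real \<Rightarrow> real"
  assumes dE: "\<And>t. a \<le> t \<Longrightarrow> (E has_vector_derivative E' t) (at t within {a..})"
    and E0: "\<And>t. a \<le> t \<Longrightarrow> 0 \<le> E t"
    and h: "continuous_on {a..} h" "\<And>t. a \<le> t \<Longrightarrow> 0 \<le> h t" "\<And>t. a \<le> t \<Longrightarrow> E' t \<le> - (k * h t)"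
    and k: "0 < k"
  shows "set_integrable lborel {a..} h"
proof (rule set_integrable_atLeast_bounded_integral[OF h(1,2), where C = "E a / k"])
  fix t assume t: "a \<le> t"
  have "(E' has_integral E t - E a) {a..t}"
    by (rule fundamental_theorem_of_calculus[OF t])
      (rule has_vector_derivative_within_subset[OF dE], auto)
  moreover have "((\<lambda>t. - (k * h t)) has_integral - (k * integral {a..t} h)) {a..t}"
    by (intro has_integral_neg has_integral_mult_right integrable_integral integrable_continuous_real
        continuous_on_subset[OF h(1)]) auto
  ultimately have "E t - E a \<le> - (k * integral {a..t} h)"
    by (rule has_integral_le) (simp add: h(3))
  then show "integral {a..t} h \<le> E a / k"
    using E0[OF t] k by (simp add: pos_le_divide_eq mult.commute)
qed

text \<open>At a first time where \<open>g\<close> equals \<open>R\<close>, the bound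
  \<open>g \<le> R\<close> has held so far, and \<open>step\<close> contradicts equality.\<close>

lemma continuous_stays_below:
  fixes g :: "real \<Rightarrow> real"
  assumes cont: "continuous_on {a..} g" and "g a < R"
    and step: "\<And>s. a \<le> s \<Longrightarrow> (\<And>r. a \<le> r \<Longrightarrow> r \<le> s \<Longrightarrow> g r \<le> R) \<Longrightarrow> g s < R"
    and "a \<le> t"
  shows "g t < R"
proof (rule ccontr)
  assume "\<not> g t < R"
  have ivt: "\<exists>r\<ge>a. r \<le> s \<and> g r = R" if "a \<le> s" "R \<le> g s" for s
    using IVT'[of g a R s] that \<open>g a < R\<close> continuous_on_subset[OF cont, of "{a..s}"] by auto
  \<comment> \<open>The infimum of this closed set is the first hitting time; by the intermediate
    value theorem \<open>g\<close> cannot exceed \<open>R\<close> without an earlier point of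
    \<open>Z\<close>.\<close>
  define Z where "Z = {a..} \<inter> g -` {R}"
  have "closed Z"
    unfolding Z_def by (rule continuous_closed_preimage[OF cont]) auto
  moreover have "Z \<noteq> {}" "bdd_below Z"
    using ivt[of t] \<open>a \<le> t\<close> \<open>\<not> g t < R\<close> by (auto simp: Z_def bdd_below_def)
  ultimately have "Inf Z \<in> Z" by (metis closed_contains_Inf)
  moreover have "g r \<le> R" if r: "a \<le> r" "r \<le> Inf Z" for r
  proof (rule ccontr)
    assume "\<not> g r \<le> R"
    then obtain q where "q \<ge> a" "q \<le> r" "g q = R" using ivt[of r] r by auto
    then have "q \<in> Z" by (simp add: Z_def)
    then have "Inf Z \<le> q" by (rule cInf_lower) fact
    then show False using r \<open>q \<le> r\<close> \<open>g q = R\<close> \<open>\<not> g r \<le> R\<close> by (metis order.antisym order.trans order_refl)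
  qed
  ultimately show False using step[of "Inf Z"] by (auto simp: Z_def)
qed

section \<open>Semilinear systems with a globally Lipschitz field\<close>

lemma ivp_semilinear:
  fixes B :: "'a::banach \<Rightarrow> 'a"
  assumes B: "bounded_linear B" and H: "L-lipschitz_on UNIV H"
    and cont\<beta>: "continuous_on {a..} \<beta>" and \<beta>: "\<forall>t\<ge>a. 0 \<le> \<beta> t"
  shows "\<exists>z. z a = z0 \<and>
    (\<forall>t\<ge>a. (z has_vector_derivative B (z t) + \<beta> t *\<^sub>R H (z t)) (at t within {a..})) \<and>
    (\<forall>y. y a = z0 \<longrightarrow> bounded (y ` {a..}) \<longrightarrow>
       (\<forall>t\<ge>a. (y has_vector_derivative B (y t) + \<beta> t *\<^sub>R H (y t)) (at t within {a..})) \<longrightarrow>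
       (\<forall>t\<ge>a. y t = z t))"
proof -
  interpret bounded_linear B by (rule B)
  obtain K where K: "\<And>z. norm (B z) \<le> norm z * K" "0 \<le> K"
    using nonneg_bounded by blast
  have L: "0 \<le> L" using lipschitz_on_nonneg[OF H] .
  \<comment> \<open>One rate has to serve twice: \<open>K + \<beta> L\<close> is needed for the
    Lipschitz condition and \<open>\<beta> |H 0|\<close> for the value at zero.\<close>
  let ?\<kappa> = "\<lambda>t. K + \<beta> t * (L + norm (H 0))"
  have "continuous_on ({a..} \<times> UNIV) (\<lambda>p. B (snd p) + \<beta> (fst p) *\<^sub>R H (snd p))"
    by (intro continuous_intros continuous_on_compose2[OF cont\<beta>]
        continuous_on_compose2[OF lipschitz_on_continuous_on[OF H]]
        continuous_on_compose2[OF linear_continuous_on[OF B]]) auto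
  then have 1: "continuous_on ({a..} \<times> UNIV) (\<lambda>(t, z). B z + \<beta> t *\<^sub>R H z)"
    by (simp add: case_prod_beta)
  have 2: "continuous_on {a..} ?\<kappa>"
    by (intro continuous_intros cont\<beta>)
  have 3: "norm ((B y + \<beta> t *\<^sub>R H y) - (B z + \<beta> t *\<^sub>R H z)) \<le> ?\<kappa> t * norm (y - z)" if t: "a \<le> t" for t y z
  proof -
    have "norm ((B y + \<beta> t *\<^sub>R H y) - (B z + \<beta> t *\<^sub>R H z)) = norm (B (y - z) + \<beta> t *\<^sub>R (H y - H z))"
      by (simp add: diff algebra_simps)
    also have "\<dots> \<le> norm (B (y - z)) + \<beta> t * norm (H y - H z)"
      using norm_triangle_ineq[of "B (y - z)" "\<beta> t *\<^sub>R (H y - H z)"] \<beta>[rule_format, OF t] by simp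
    also have "\<dots> \<le> K * norm (y - z) + \<beta> t * ((L + norm (H 0)) * norm (y - z))"
    proof (intro add_mono mult_left_mono \<beta>[rule_format, OF t])
      show "norm (B (y - z)) \<le> K * norm (y - z)" using K(1)[of "y - z"] by (simp add: mult.commute)
      have "norm (H y - H z) \<le> L * norm (y - z)"
        using lipschitz_on_normD[OF H] by blast
      also have "\<dots> \<le> (L + norm (H 0)) * norm (y - z)"
        by (intro mult_right_mono) auto
      finally show "norm (H y - H z) \<le> (L + norm (H 0)) * norm (y - z)" .
    qed
    finally show ?thesis by (simp add: algebra_simps)
  qed
  have 4: "norm (B 0 + \<beta> t *\<^sub>R H 0) \<le> ?\<kappa> t" if "a \<le> t" for t
    using \<beta>[rule_format, OF that] K(2) L by (simp add: zero add_increasing distrib_left)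
  show ?thesis
    by (rule ivp_linear_growth[OF 1 2 3 4])
qed

text \<open>Projection onto a closed convex set is nonexpansive, so this extends \<open>g\<close>
  from \<open>S\<close> to the whole space with the same constant.\<close>

lemma lipschitz_on_closest_point_compose:
  fixes g :: "'a::euclidean_space \<Rightarrow> 'b::metric_space"
  assumes "L-lipschitz_on S g" "convex S" "closed S" "S \<noteq> {}"
  shows "L-lipschitz_on UNIV (\<lambda>x. g (closest_point S x))"
proof -
  have "1-lipschitz_on UNIV (closest_point S)"
    using closest_point_lipschitz[OF assms(2-4)] by (auto intro: lipschitz_onI)
  then have "(L * 1)-lipschitz_on UNIV (\<lambda>x. g (closest_point S x))"
    using closest_point_in_set[OF assms(3,4)]
    by (intro lipschitz_on_compose2 lipschitz_on_subset[OF assms(1)]) auto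
  then show ?thesis by simp
qed

section \<open>The second-order system in first-order form\<close>

lemma deriv_from_eqI:
  assumes "(x has_vector_derivative d) (at t within {t0..})" "t0 \<le> t"
  shows "deriv_from t0 x t = d"
proof -
  \<comment> \<open>An interval to the right makes \<open>t\<close> a limit point even when
    \<open>t = t0\<close>, so the one-sided derivative is unique.\<close>
  have "at t within {t0..} \<noteq> bot"
    using islimpt_subset[of t "{t..t + 1}" "{t0..}"] assms(2) by (auto simp: trivial_limit_within)
  then show ?thesis
    unfolding deriv_from_def using assms(1) by (rule vector_derivative_within)
qed

lemma C1_fromI:
  assumes "\<And>t. t0 \<le> t \<Longrightarrow> (x has_vector_derivative d t) (at t within {t0..})" "continuous_on {t0..} d"
  shows "C1_from t0 x"
proof -
  have "d t = deriv_from t0 x t" if "t \<in> {t0..}" for t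
    using that by (intro deriv_from_eqI[symmetric] assms(1)) auto
  then have "continuous_on {t0..} (deriv_from t0 x)"
    by (rule continuous_on_eq[OF assms(2)])
  moreover have "x differentiable_on {t0..}"
    unfolding differentiable_on_def by (intro ballI differentiableI_vector[OF assms(1)]) simp
  ultimately show ?thesis unfolding C1_from_def by blast
qed

lemma C1_fromD:
  assumes "C1_from t0 x" "t0 \<le> t"
  shows "(x has_vector_derivative deriv_from t0 x t) (at t within {t0..})"
  using assms unfolding C1_from_def deriv_from_def differentiable_on_def
  by (simp flip: vector_derivative_works)

text \<open>The velocity \<open>u\<close> becomes an unknown of its own, and the gradient is
  replaced by an arbitrary field \<open>g\<close> so that the same notion covers the truncated
  problem.\<close>

definition flow_solution ::
  "real \<Rightarrow> real \<Rightarrow> real \<Rightarrow> real \<Rightarrow> (real \<Rightarrow> real) \<Rightarrow> (real^'n \<Rightarrow> real^'n) \<Rightarrow> real^'n^'m \<Rightarrow> real^'m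
    \<Rightarrow> real^'n \<Rightarrow> real^'m \<Rightarrow> real^'n \<Rightarrow> (real \<Rightarrow> real^'n) \<Rightarrow> (real \<Rightarrow> real^'m) \<Rightarrow> (real \<Rightarrow> real^'n) \<Rightarrow> bool" where
  "flow_solution t0 \<gamma> \<delta> \<sigma> \<beta> g A b x0 l0 u0 x l u \<longleftrightarrow>
     x t0 = x0 \<and> l t0 = l0 \<and> u t0 = u0 \<and>
     (\<forall>t\<ge>t0. (x has_vector_derivative u t) (at t within {t0..}) \<and>
        (u has_vector_derivative - (\<beta> t *\<^sub>R (g (x t) + transpose A *v l t
           + \<sigma> *\<^sub>R (transpose A *v (A *v x t - b)))) - \<gamma> *\<^sub>R u t) (at t within {t0..}) \<and>
        (l has_vector_derivative \<beta> t *\<^sub>R (A *v (x t + \<delta> *\<^sub>R u t) - b)) (at t within {t0..}))"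

lemma global_solution_imp_flow_solution:
  assumes "global_solution t0 \<gamma> \<delta> \<sigma> \<beta> f A b x0 l0 u0 x l"
  shows "flow_solution t0 \<gamma> \<delta> \<sigma> \<beta> (gradient f) A b x0 l0 u0 x l (deriv_from t0 x)"
proof -
  note gs = assms[unfolded global_solution_def C2_from_def]
  show ?thesis
    unfolding flow_solution_def
  proof (intro conjI allI impI)
    fix t assume t: "t0 \<le> t"
    show "(x has_vector_derivative deriv_from t0 x t) (at t within {t0..})"
      using gs t by (blast intro: C1_fromD)
    have "deriv_from t0 (deriv_from t0 x) t = - (\<beta> t *\<^sub>R (gradient f (x t) + transpose A *v l t
           + \<sigma> *\<^sub>R (transpose A *v (A *v x t - b)))) - \<gamma> *\<^sub>R deriv_from t0 x t"
      using gs t by (metis add_diff_cancel)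
    then show "(deriv_from t0 x has_vector_derivative - (\<beta> t *\<^sub>R (gradient f (x t) + transpose A *v l t
           + \<sigma> *\<^sub>R (transpose A *v (A *v x t - b)))) - \<gamma> *\<^sub>R deriv_from t0 x t) (at t within {t0..})"
      using gs t by (metis C1_fromD)
    have "deriv_from t0 l t = \<beta> t *\<^sub>R (A *v (x t + \<delta> *\<^sub>R deriv_from t0 x t) - b)"
      using gs t by blast
    then show "(l has_vector_derivative \<beta> t *\<^sub>R (A *v (x t + \<delta> *\<^sub>R deriv_from t0 x t) - b)) (at t within {t0..})"
      using gs t by (metis C1_fromD)
  qed (use gs in blast)+
qed

lemma flow_solution_continuous_on:
  assumes "flow_solution t0 \<gamma> \<delta> \<sigma> \<beta> g A b x0 l0 u0 x l u"
  shows "continuous_on {t0..} x" "continuous_on {t0..} l" "continuous_on {t0..} u"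
  using assms unfolding flow_solution_def
  by - (rule continuous_on_derivative_atLeast, blast)+

text \<open>Regularity comes from the equations: differentiable components are continuous, so the
  right-hand sides are continuous, which gives the required one or two continuous
  derivatives.\<close>

lemma flow_solution_imp_global_solution:
  fixes A :: "real^'n^'m"
  assumes fs: "flow_solution t0 \<gamma> \<delta> \<sigma> \<beta> (gradient f) A b x0 l0 u0 x l u"
    and f: "continuous_on UNIV (gradient f)" and \<beta>: "continuous_on {t0..} \<beta>"
  shows "global_solution t0 \<gamma> \<delta> \<sigma> \<beta> f A b x0 l0 u0 x l"
    and "\<And>t. t0 \<le> t \<Longrightarrow> deriv_from t0 x t = u t"
proof -
  have d: "(x has_vector_derivative u t) (at t within {t0..})"
    "(u has_vector_derivative - (\<beta> t *\<^sub>R (gradient f (x t) + transpose A *v l t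
           + \<sigma> *\<^sub>R (transpose A *v (A *v x t - b)))) - \<gamma> *\<^sub>R u t) (at t within {t0..})"
    "(l has_vector_derivative \<beta> t *\<^sub>R (A *v (x t + \<delta> *\<^sub>R u t) - b)) (at t within {t0..})"
    if "t0 \<le> t" for t
    using fs that unfolding flow_solution_def by blast+
  note cont = flow_solution_continuous_on[OF fs]
  note cA = continuous_on_compose2[OF linear_continuous_on[OF matrix_vector_mul_bounded_linear]]
  show du: "deriv_from t0 x t = u t" if "t0 \<le> t" for t
    using d(1)[OF that] that by (rule deriv_from_eqI)
  let ?l' = "\<lambda>t. \<beta> t *\<^sub>R (A *v (x t + \<delta> *\<^sub>R u t) - b)"
  let ?u' = "\<lambda>t. - (\<beta> t *\<^sub>R (gradient f (x t) + transpose A *v l t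
           + \<sigma> *\<^sub>R (transpose A *v (A *v x t - b)))) - \<gamma> *\<^sub>R u t"
  have du': "(deriv_from t0 x has_vector_derivative ?u' t) (at t within {t0..})" if "t0 \<le> t" for t
    using that by (intro has_vector_derivative_transform[OF _ _ d(2)[OF that]]) (auto simp: du)
  have "C1_from t0 x"
    by (rule C1_fromI[OF d(1) cont(3)])
  moreover have "C1_from t0 (deriv_from t0 x)"
    by (intro C1_fromI[OF du'] continuous_intros cont cA \<beta> continuous_on_compose2[OF f]) auto
  moreover have "C1_from t0 l"
    by (intro C1_fromI[OF d(3)] continuous_intros cont cA \<beta>) auto
  moreover have "deriv_from t0 (deriv_from t0 x) t = ?u' t" "deriv_from t0 l t = ?l' t" if "t0 \<le> t" for t
    using deriv_from_eqI[OF du'[OF that] that] deriv_from_eqI[OF d(3)[OF that] that] by blast+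
  ultimately show "global_solution t0 \<gamma> \<delta> \<sigma> \<beta> f A b x0 l0 u0 x l"
    using fs by (auto simp: global_solution_def C2_from_def du flow_solution_def)
qed

text \<open>The triple \<open>(x, l, u)\<close> solves a semilinear problem. \<open>?B\<close>
  collects the terms without the factor \<open>\<beta>\<close> (velocity and damping); the terms
  with it split into the linear \<open>?M\<close> and the remainder \<open>?N\<close>, which carries
  \<open>g\<close> and \<open>b\<close>.\<close>

lemma flow_solution_exists:
  fixes A :: "real^'n^'m"
  assumes g: "L-lipschitz_on UNIV g"
    and cont\<beta>: "continuous_on {t0..} \<beta>" and \<beta>: "\<forall>t\<ge>t0. 0 \<le> \<beta> t"
  shows "\<exists>x l u. flow_solution t0 \<gamma> \<delta> \<sigma> \<beta> g A b x0 l0 u0 x l u \<and>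
    (\<forall>y m v. flow_solution t0 \<gamma> \<delta> \<sigma> \<beta> g A b x0 l0 u0 y m v \<longrightarrow>
       bounded ((\<lambda>t. (y t, m t, v t)) ` {t0..}) \<longrightarrow> (\<forall>t\<ge>t0. y t = x t \<and> m t = l t))"
proof -
  let ?B = "\<lambda>z::(real^'n) \<times> (real^'m) \<times> (real^'n). (snd (snd z), 0::real^'m, - (\<gamma> *\<^sub>R snd (snd z)))"
  let ?M = "\<lambda>z::(real^'n) \<times> (real^'m) \<times> (real^'n).
     (0::real^'n, A *v (fst z + \<delta> *\<^sub>R snd (snd z)),
      - (transpose A *v fst (snd z) + \<sigma> *\<^sub>R (transpose A *v (A *v fst z))))"
  let ?N = "\<lambda>z::(real^'n) \<times> (real^'m) \<times> (real^'n).
     (0::real^'n, - b, - (g (fst z) - \<sigma> *\<^sub>R (transpose A *v b)))"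
  have B: "bounded_linear ?B"
    by (intro linear_conv_bounded_linear[THEN iffD1] linearI) (simp_all add: algebra_simps)
  have "bounded_linear ?M"
    by (intro linear_conv_bounded_linear[THEN iffD1] linearI)
      (simp_all add: matrix_vector_right_distrib matrix_vector_mult_scaleR algebra_simps
        del: transpose_matrix_vector)
  then obtain C where C: "\<And>z. norm (?M z) \<le> norm z * C" "0 \<le> C"
    using bounded_linear.nonneg_bounded by blast
  have M: "C-lipschitz_on UNIV ?M"
  proof (rule lipschitz_onI[OF _ C(2)])
    fix y z show "dist (?M y) (?M z) \<le> C * dist y z"
      using C(1)[of "y - z"] linear_diff[OF bounded_linear.linear[OF \<open>bounded_linear ?M\<close>], of y z]
      unfolding dist_norm by (simp only: mult.commute)
  qed
  have N: "L-lipschitz_on UNIV ?N"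
  proof (rule lipschitz_onI[OF _ lipschitz_on_nonneg[OF g]])
    fix y z
    have "dist (?N y) (?N z) = dist (g (fst y)) (g (fst z))"
      by (simp add: dist_Pair_Pair dist_norm norm_minus_commute)
    also have "\<dots> \<le> L * dist (fst y) (fst z)"
      using lipschitz_onD[OF g] by blast
    also have "\<dots> \<le> L * dist y z"
      using dist_fst_le[of y z] lipschitz_on_nonneg[OF g] by (rule mult_left_mono)
    finally show "dist (?N y) (?N z) \<le> L * dist y z" .
  qed
  let ?F = "\<lambda>t z. ?B z + \<beta> t *\<^sub>R (?M z + ?N z)"
  from ivp_semilinear[OF B lipschitz_on_add[OF M N] cont\<beta> \<beta>, of "(x0, l0, u0)"]
  obtain z where z0: "z t0 = (x0, l0, u0)"
    and dz: "\<forall>t\<ge>t0. (z has_vector_derivative ?F t (z t)) (at t within {t0..})"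
    and uniq: "\<forall>y. y t0 = (x0, l0, u0) \<longrightarrow> bounded (y ` {t0..}) \<longrightarrow>
       (\<forall>t\<ge>t0. (y has_vector_derivative ?F t (y t)) (at t within {t0..})) \<longrightarrow>
       (\<forall>t\<ge>t0. y t = z t)"
    by (elim exE conjE) (rule that)
  have F: "?F t y = (snd (snd y), \<beta> t *\<^sub>R (A *v (fst y + \<delta> *\<^sub>R snd (snd y)) - b),
      - (\<beta> t *\<^sub>R (g (fst y) + transpose A *v fst (snd y) + \<sigma> *\<^sub>R (transpose A *v (A *v fst y - b))))
      - \<gamma> *\<^sub>R snd (snd y))" for t y
    by (simp add: matrix_vector_mult_diff_distrib algebra_simps del: transpose_matrix_vector)
  show ?thesis
  proof (rule exI[of _ "\<lambda>t. fst (z t)"], rule exI[of _ "\<lambda>t. fst (snd (z t))"],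
      rule exI[of _ "\<lambda>t. snd (snd (z t))"], intro conjI allI impI)
    show "flow_solution t0 \<gamma> \<delta> \<sigma> \<beta> g A b x0 l0 u0 (\<lambda>t. fst (z t)) (\<lambda>t. fst (snd (z t))) (\<lambda>t. snd (snd (z t)))"
      unfolding flow_solution_def
    proof (intro conjI allI impI)
      fix t assume t: "t0 \<le> t"
      note dz = dz[rule_format, OF t, unfolded F]
      note bl = bounded_linear.has_vector_derivative
      from bl[OF bounded_linear_fst dz]
      show "((\<lambda>t. fst (z t)) has_vector_derivative snd (snd (z t))) (at t within {t0..})" by simp
      note dz' = bl[OF bounded_linear_snd dz]
      show "((\<lambda>t. fst (snd (z t))) has_vector_derivative
          \<beta> t *\<^sub>R (A *v (fst (z t) + \<delta> *\<^sub>R snd (snd (z t))) - b)) (at t within {t0..})"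
        using bl[OF bounded_linear_fst dz'] by simp
      show "((\<lambda>t. snd (snd (z t))) has_vector_derivative
          - (\<beta> t *\<^sub>R (g (fst (z t)) + transpose A *v fst (snd (z t))
            + \<sigma> *\<^sub>R (transpose A *v (A *v fst (z t) - b)))) - \<gamma> *\<^sub>R snd (snd (z t))) (at t within {t0..})"
        using bl[OF bounded_linear_snd dz'] by simp
    qed (simp_all add: z0)
  next
    fix y m v t
    assume fs: "flow_solution t0 \<gamma> \<delta> \<sigma> \<beta> g A b x0 l0 u0 y m v"
      and bdd: "bounded ((\<lambda>t. (y t, m t, v t)) ` {t0..})" and t: "t0 \<le> t"
    have "(y t0, m t0, v t0) = (x0, l0, u0)" using fs by (simp add: flow_solution_def)
    moreover have "\<forall>t\<ge>t0. ((\<lambda>t. (y t, m t, v t)) has_vector_derivative ?F t (y t, m t, v t)) (at t within {t0..})"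
      unfolding F unfolding fst_conv snd_conv using fs unfolding flow_solution_def
      by (intro allI impI has_vector_derivative_Pair) auto
    ultimately have "(y t, m t, v t) = z t"
      using uniq[THEN spec, of "\<lambda>t. (y t, m t, v t)"] bdd t by blast
    then show "y t = fst (z t)" "m t = fst (snd (z t))" by (metis fst_conv snd_conv)+
  qed
qed

section \<open>A priori bounds along the primal-dual flow\<close>

text \<open>One saddle point is fixed because the Lyapunov function depends on it; statements about
  all saddle points come from instantiating the locale at each of them.\<close>

locale primal_dual_flow =
  fixes t0 \<gamma> \<delta> \<sigma> :: real and A :: "real^'n^'m" and b :: "real^'m"
    and f :: "real^'n \<Rightarrow> real" and \<beta> :: "real \<Rightarrow> real" and xs :: "real^'n" and ls :: "real^'m"
  assumes \<delta>: "0 < \<delta>" and \<sigma>: "0 < \<sigma>" and \<gamma>: "1 / \<delta> < \<gamma>"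
    and convex: "convex_on UNIV f" and C1: "continuously_differentiable f"
    and saddle: "(xs, ls) \<in> saddle_points f A b"
    and \<beta>_pos: "\<And>t. t0 \<le> t \<Longrightarrow> 0 < \<beta> t" and C1\<beta>: "C1_from t0 \<beta>"
    and growth: "\<And>t. t0 \<le> t \<Longrightarrow> deriv_from t0 \<beta> t \<le> 1 / \<delta> * \<beta> t"
begin

abbreviation "gap x \<equiv> aug_lagrangian \<sigma> f A b x ls - f xs"

abbreviation "E c x l u \<equiv> lyapunov (1 / \<delta>) \<gamma> \<sigma> f A b xs ls c x l u"

lemma gap_ge: "lagrangian f A b x ls - f xs \<le> gap x" "\<sigma> / 2 * (norm (A *v x - b))\<^sup>2 \<le> gap x" "0 \<le> gap x"
proof -
  have "0 \<le> lagrangian f A b x ls - f xs" "0 \<le> \<sigma> / 2 * (norm (A *v x - b))\<^sup>2"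
    using saddle_points_minimizer[OF saddle] \<sigma> by auto
  then show "lagrangian f A b x ls - f xs \<le> gap x" "\<sigma> / 2 * (norm (A *v x - b))\<^sup>2 \<le> gap x" "0 \<le> gap x"
    by (auto simp: aug_lagrangian_def)
qed

lemma E_ge:
  assumes "0 \<le> c"
  shows "c * gap x \<le> E c x l u"
    "(norm ((1 / \<delta>) *\<^sub>R (x - xs) + u))\<^sup>2 / 2 \<le> E c x l u"
    "1 / \<delta> * (\<gamma> - 1 / \<delta>) / 2 * (norm (x - xs))\<^sup>2 \<le> E c x l u"
    "1 / \<delta> / 2 * (norm (l - ls))\<^sup>2 \<le> E c x l u"
    "0 \<le> E c x l u"
  using lyapunov_lower_bounds[OF saddle, of "1 / \<delta>" \<gamma> \<sigma> c] \<delta> \<sigma> \<gamma> assms by auto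

text \<open>The bound is uniform in \<open>c \<ge> 0\<close>, since the quadratic terms of
  \<open>E\<close> do not involve \<open>c\<close>; hence it is independent of the size of
  \<open>\<beta>\<close>.\<close>

lemma E_sublevel_bounded:
  "\<exists>B\<ge>0. \<forall>c x l u. 0 \<le> c \<longrightarrow> E c x l u \<le> M \<longrightarrow> norm x \<le> B \<and> norm l \<le> B \<and> norm u \<le> B"
proof -
  \<comment> \<open>Radii for \<open>x - xs\<close>, \<open>l - ls\<close> and the mixed term
    \<open>(x - xs) / \<delta> + u\<close>; the velocity is then bounded by
    \<open>r'' + r / \<delta>\<close>. The absolute value keeps them nonnegative for every
    \<open>M\<close>.\<close>
  define r where "r = sqrt (\<bar>M\<bar> / (1 / \<delta> * (\<gamma> - 1 / \<delta>) / 2))"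
  define r' where "r' = sqrt (\<bar>M\<bar> / (1 / \<delta> / 2))"
  define r'' where "r'' = sqrt (\<bar>M\<bar> / (1 / 2))"
  have sqrt: "norm y \<le> sqrt (\<bar>M\<bar> / k)" if "k * (norm y)\<^sup>2 \<le> M" "0 < k"
    for k and y :: "'a::real_normed_vector"
  proof (rule real_le_rsqrt)
    have "(norm y)\<^sup>2 * k \<le> \<bar>M\<bar>" using that(1) by (simp add: mult.commute)
    then show "(norm y)\<^sup>2 \<le> \<bar>M\<bar> / k" by (simp add: pos_le_divide_eq[OF that(2)])
  qed
  have nonneg: "0 \<le> r" "0 \<le> r'" "0 \<le> r''"
    using \<delta> \<gamma> by (auto simp: r_def r'_def r''_def)
  have k: "0 < 1 / \<delta> * (\<gamma> - 1 / \<delta>) / 2" "0 < 1 / \<delta> / 2" using \<delta> \<gamma> by auto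
  show ?thesis
  proof (intro exI[of _ "norm xs + norm ls + r + r' + (r'' + 1 / \<delta> * r)"] conjI[of "0 \<le> _"] allI impI)
    show "0 \<le> norm xs + norm ls + r + r' + (r'' + 1 / \<delta> * r)"
      using nonneg \<delta> by simp
    fix c x l u assume c: "0 \<le> c" and M: "E c x l u \<le> M"
    have x: "norm (x - xs) \<le> r"
      unfolding r_def using E_ge(3)[OF c, of x l u] M k(1) by (intro sqrt) auto
    have l: "norm (l - ls) \<le> r'"
      unfolding r'_def using E_ge(4)[OF c, of l x u] M k(2) by (intro sqrt) auto
    have v: "norm ((1 / \<delta>) *\<^sub>R (x - xs) + u) \<le> r''"
      unfolding r''_def using E_ge(2)[OF c, of x u l] M by (intro sqrt) auto
    have "norm u \<le> norm ((1 / \<delta>) *\<^sub>R (x - xs) + u) + norm ((1 / \<delta>) *\<^sub>R (x - xs))"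
      using norm_triangle_ineq4[of "(1 / \<delta>) *\<^sub>R (x - xs) + u" "(1 / \<delta>) *\<^sub>R (x - xs)"] by simp
    moreover have "norm ((1 / \<delta>) *\<^sub>R (x - xs)) \<le> 1 / \<delta> * r"
      using mult_left_mono[OF x, of "1 / \<delta>"] \<delta> by simp
    moreover have "norm x \<le> norm xs + norm (x - xs)" "norm l \<le> norm ls + norm (l - ls)"
      using norm_triangle_sub by blast+
    moreover have "0 \<le> 1 / \<delta> * r" using nonneg \<delta> by simp
    ultimately show "norm x \<le> norm xs + norm ls + r + r' + (r'' + 1 / \<delta> * r) \<and>
        norm l \<le> norm xs + norm ls + r + r' + (r'' + 1 / \<delta> * r) \<and>
        norm u \<le> norm xs + norm ls + r + r' + (r'' + 1 / \<delta> * r)"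
      using x l v nonneg norm_ge_zero[of xs] norm_ge_zero[of ls] by linarith
  qed
qed

lemma GDERIV_f: "GDERIV f x :> gradient f x"
  using C1 by (auto simp: continuously_differentiable_def intro: GDERIV_gradient)

lemma continuous_on_\<beta>: "continuous_on {t0..} \<beta>"
  by (rule continuous_on_derivative_atLeast[OF C1_fromD[OF C1\<beta>]])

text \<open>Only the value of \<open>g\<close> at the current point enters, so agreement with the
  gradient there suffices; this makes the estimate available for the truncated flow.\<close>

lemma E_derivative:
  assumes fs: "flow_solution t0 \<gamma> \<delta> \<sigma> \<beta> g A b x0 l0 u0 x l u"
    and t: "t0 \<le> t" and g: "g (x t) = gradient f (x t)"
  shows "\<exists>D. ((\<lambda>t. E (\<beta> t) (x t) (l t) (u t)) has_vector_derivative D) (at t within {t0..}) \<and>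
    D \<le> - ((1 / \<delta> * \<beta> t - deriv_from t0 \<beta> t) * gap (x t)
      + \<sigma> / (2 * \<delta>) * (\<beta> t * (norm (A *v x t - b))\<^sup>2) + (\<gamma> - 1 / \<delta>) * (norm (u t))\<^sup>2)"
proof (intro exI conjI)
  have d: "(x has_vector_derivative u t) (at t within {t0..})"
    "(u has_vector_derivative - (\<beta> t *\<^sub>R (gradient f (x t) + transpose A *v l t
           + \<sigma> *\<^sub>R (transpose A *v (A *v x t - b)))) - \<gamma> *\<^sub>R u t) (at t within {t0..})"
    "(l has_vector_derivative \<beta> t *\<^sub>R (A *v (x t + (1 / (1 / \<delta>)) *\<^sub>R u t) - b)) (at t within {t0..})"
    using fs t \<delta> unfolding flow_solution_def by (auto simp: g)
  have a: "1 / \<delta> \<noteq> 0" using \<delta> by simp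
  note feas = saddle_points_feasible[OF saddle]
  let ?G = "(x t - xs) \<bullet> (gradient f (x t) + transpose A *v ls + \<sigma> *\<^sub>R (transpose A *v (A *v x t - b)))"
  show "((\<lambda>t. E (\<beta> t) (x t) (l t) (u t)) has_vector_derivative
      deriv_from t0 \<beta> t * gap (x t) - 1 / \<delta> * \<beta> t * ?G - (\<gamma> - 1 / \<delta>) * (norm (u t))\<^sup>2) (at t within {t0..})"
    by (rule lyapunov_has_derivative[OF GDERIV_f d C1_fromD[OF C1\<beta> t] feas a])
  have "0 \<le> 1 / \<delta> * \<beta> t" using \<delta> \<beta>_pos[OF t] by simp
  from mult_left_mono[OF aug_lagrangian_gap_gradient[OF convex GDERIV_f feas, of \<sigma> "x t" ls] this]
  show "deriv_from t0 \<beta> t * gap (x t) - 1 / \<delta> * \<beta> t * ?G - (\<gamma> - 1 / \<delta>) * (norm (u t))\<^sup>2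
    \<le> - ((1 / \<delta> * \<beta> t - deriv_from t0 \<beta> t) * gap (x t)
      + \<sigma> / (2 * \<delta>) * (\<beta> t * (norm (A *v x t - b))\<^sup>2) + (\<gamma> - 1 / \<delta>) * (norm (u t))\<^sup>2)"
    by (simp add: algebra_simps)
qed

lemma dissipation_nonneg:
  assumes "t0 \<le> t"
  shows "0 \<le> (1 / \<delta> * \<beta> t - deriv_from t0 \<beta> t) * gap x"
    "0 \<le> \<sigma> / (2 * \<delta>) * (\<beta> t * (norm (A *v x - b))\<^sup>2)" "0 \<le> (\<gamma> - 1 / \<delta>) * (norm u)\<^sup>2"
  using growth[OF assms] gap_ge(3)[of x] \<beta>_pos[OF assms] \<delta> \<sigma> \<gamma> by auto

text \<open>Agreement of \<open>g\<close> with the gradient is asked only up to time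
  \<open>s\<close>, as the barrier argument supplies it only on an initial interval.\<close>

lemma E_decreasing:
  assumes fs: "flow_solution t0 \<gamma> \<delta> \<sigma> \<beta> g A b x0 l0 u0 x l u"
    and s: "t0 \<le> s" and g: "\<And>t. t0 \<le> t \<Longrightarrow> t \<le> s \<Longrightarrow> g (x t) = gradient f (x t)"
  shows "E (\<beta> s) (x s) (l s) (u s) \<le> E (\<beta> t0) x0 l0 u0"
proof -
  let ?E = "\<lambda>t. E (\<beta> t) (x t) (l t) (u t)"
  have "\<forall>t\<in>{t0..s}. \<exists>D. (?E has_vector_derivative D) (at t within {t0..}) \<and> D \<le> 0"
  proof
    fix t assume t: "t \<in> {t0..s}"
    then have "t0 \<le> t" "g (x t) = gradient f (x t)" using g by auto
    from E_derivative[OF fs this] dissipation_nonneg(1,2)[OF this(1), of "x t"] dissipation_nonneg(3)[OF this(1), of "u t"]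
    show "\<exists>D. (?E has_vector_derivative D) (at t within {t0..}) \<and> D \<le> 0"
      by fastforce
  qed
  then obtain D where D: "\<And>t. t \<in> {t0..s} \<Longrightarrow> (?E has_vector_derivative D t) (at t within {t0..})"
    "\<And>t. t \<in> {t0..s} \<Longrightarrow> D t \<le> 0"
    by metis
  have "(D has_integral ?E s - ?E t0) {t0..s}"
    by (rule fundamental_theorem_of_calculus[OF s])
      (rule has_vector_derivative_within_subset[OF D(1)], auto)
  from has_integral_le[OF this has_integral_0 D(2)] show ?thesis
    using fs by (simp add: flow_solution_def)
qed

text \<open>While the trajectory stays in the ball of radius \<open>R\<close>, \<open>g\<close> acts
  as the gradient and \<open>E\<close> does not exceed its initial value. That forces the norm to be
  at most \<open>B\<close>, strictly below \<open>R\<close>, so the barrier is never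
  reached.\<close>

lemma flow_solution_confined:
  assumes fs: "flow_solution t0 \<gamma> \<delta> \<sigma> \<beta> g A b x0 l0 u0 x l u"
    and B: "\<And>c x l u. 0 \<le> c \<Longrightarrow> E c x l u \<le> E (\<beta> t0) x0 l0 u0 \<Longrightarrow> norm x \<le> B"
    and "B < R" and g: "\<And>y. norm y \<le> R \<Longrightarrow> g y = gradient f y"
    and t: "t0 \<le> t"
  shows "norm (x t) < R"
proof (rule continuous_stays_below[of t0 "\<lambda>t. norm (x t)", OF _ _ _ t])
  show "continuous_on {t0..} (\<lambda>t. norm (x t))"
    by (intro continuous_intros flow_solution_continuous_on[OF fs])
  have less: "norm (x s) < R" if "t0 \<le> s" "E (\<beta> s) (x s) (l s) (u s) \<le> E (\<beta> t0) x0 l0 u0" for s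
    using B[OF less_imp_le[OF \<beta>_pos[OF that(1)]] that(2)] \<open>B < R\<close> by simp
  show "norm (x t0) < R"
    using fs by (intro less) (simp_all add: flow_solution_def)
  show "norm (x s) < R" if "t0 \<le> s" "\<And>r. t0 \<le> r \<Longrightarrow> r \<le> s \<Longrightarrow> norm (x r) \<le> R" for s
    using that by (intro less E_decreasing[OF fs] g) auto
qed

text \<open>The dissipation has three nonnegative parts; keeping one at a time gives the three
  integrals, with its coefficient as the constant \<open>k\<close>. The rates come from the first
  summand of \<open>E\<close>, which gives \<open>\<beta> gap \<le> E(t0)\<close>.\<close>

lemma flow_solution_estimates:
  assumes fs: "flow_solution t0 \<gamma> \<delta> \<sigma> \<beta> (gradient f) A b x0 l0 u0 x l u"
  shows "bounded ((\<lambda>t. (x t, l t, u t)) ` {t0..})"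
    and "set_integrable lborel {t0..} (\<lambda>t. (1 / \<delta> * \<beta> t - deriv_from t0 \<beta> t) * gap (x t))"
    and "set_integrable lborel {t0..} (\<lambda>t. \<beta> t * (norm (A *v x t - b))\<^sup>2)"
    and "set_integrable lborel {t0..} (\<lambda>t. (norm (u t))\<^sup>2)"
    and "(\<lambda>t. lagrangian f A b (x t) ls - f xs) \<in> O[at_top](\<lambda>t. 1 / \<beta> t)"
    and "(\<lambda>t. norm (A *v x t - b)) \<in> O[at_top](\<lambda>t. 1 / sqrt (\<beta> t))"
proof -
  let ?E = "\<lambda>t. E (\<beta> t) (x t) (l t) (u t)"
  let ?C = "E (\<beta> t0) x0 l0 u0"
  have E0: "?E t \<le> ?C" if "t0 \<le> t" for t
    by (rule E_decreasing[OF fs that refl])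
  obtain B where B: "0 \<le> B" "\<And>c x l u. 0 \<le> c \<Longrightarrow> E c x l u \<le> ?C \<Longrightarrow> norm x \<le> B \<and> norm l \<le> B \<and> norm u \<le> B"
    using E_sublevel_bounded[of ?C] by blast
  have "norm (x t, l t, u t) \<le> B + (B + B)" if "t0 \<le> t" for t
    using B(2)[OF less_imp_le[OF \<beta>_pos[OF that]] E0[OF that]] norm_Pair_le[of "x t" "(l t, u t)"]
      norm_Pair_le[of "l t" "u t"] by linarith
  then show "bounded ((\<lambda>t. (x t, l t, u t)) ` {t0..})"
    by (intro boundedI[of _ "B + (B + B)"]) auto
  have "\<forall>t\<in>{t0..}. \<exists>D. (?E has_vector_derivative D) (at t within {t0..}) \<and>
      D \<le> - ((1 / \<delta> * \<beta> t - deriv_from t0 \<beta> t) * gap (x t)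
      + \<sigma> / (2 * \<delta>) * (\<beta> t * (norm (A *v x t - b))\<^sup>2) + (\<gamma> - 1 / \<delta>) * (norm (u t))\<^sup>2)"
    by (intro ballI E_derivative[OF fs _ refl]) simp
  from bchoice[OF this] obtain D where dE: "\<And>t. t0 \<le> t \<Longrightarrow> (?E has_vector_derivative D t) (at t within {t0..})"
    and D: "\<And>t. t0 \<le> t \<Longrightarrow> D t \<le> - ((1 / \<delta> * \<beta> t - deriv_from t0 \<beta> t) * gap (x t)
      + \<sigma> / (2 * \<delta>) * (\<beta> t * (norm (A *v x t - b))\<^sup>2) + (\<gamma> - 1 / \<delta>) * (norm (u t))\<^sup>2)"
    by auto
  have nonneg: "0 \<le> ?E t" if "t0 \<le> t" for t
    by (rule E_ge(5)[OF less_imp_le[OF \<beta>_pos[OF that]]])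
  note cont = flow_solution_continuous_on[OF fs]
  note integrable = set_integrable_dissipation[OF dE nonneg]
  have contf: "continuous_on UNIV f"
    using GDERIV_f by (intro continuous_at_imp_continuous_on ballI has_derivative_continuous)
      (auto simp: gderiv_def)
  have contA: "continuous_on {t0..} (\<lambda>t. A *v x t)"
    by (rule continuous_on_compose2[OF linear_continuous_on[OF matrix_vector_mul_bounded_linear] cont(1)]) auto
  have cont\<beta>': "continuous_on {t0..} (deriv_from t0 \<beta>)"
    using C1\<beta> by (simp add: C1_from_def)
  show "set_integrable lborel {t0..} (\<lambda>t. (1 / \<delta> * \<beta> t - deriv_from t0 \<beta> t) * gap (x t))"
  proof (rule integrable[where k = 1])
    show "continuous_on {t0..} (\<lambda>t. (1 / \<delta> * \<beta> t - deriv_from t0 \<beta> t) * gap (x t))"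
      unfolding aug_lagrangian_def lagrangian_def
      by (intro continuous_intros cont contA continuous_on_\<beta> cont\<beta>' continuous_on_compose2[OF contf]) auto
    show "D t \<le> - (1 * ((1 / \<delta> * \<beta> t - deriv_from t0 \<beta> t) * gap (x t)))" if "t0 \<le> t" for t
      using D[OF that] dissipation_nonneg(1,2)[OF that, of "x t"] dissipation_nonneg(3)[OF that, of "u t"] by linarith
  qed (rule dissipation_nonneg(1) zero_less_one | assumption)+
  show "set_integrable lborel {t0..} (\<lambda>t. \<beta> t * (norm (A *v x t - b))\<^sup>2)"
  proof (rule integrable[where k = "\<sigma> / (2 * \<delta>)"])
    show "continuous_on {t0..} (\<lambda>t. \<beta> t * (norm (A *v x t - b))\<^sup>2)"
      by (intro continuous_intros contA continuous_on_\<beta>)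
    show "0 \<le> \<beta> t * (norm (A *v x t - b))\<^sup>2" if "t0 \<le> t" for t
      using \<beta>_pos[OF that] by simp
    show "D t \<le> - (\<sigma> / (2 * \<delta>) * (\<beta> t * (norm (A *v x t - b))\<^sup>2))" if "t0 \<le> t" for t
      using D[OF that] dissipation_nonneg(1,2)[OF that, of "x t"] dissipation_nonneg(3)[OF that, of "u t"] by linarith
  qed (use \<delta> \<sigma> in auto)
  show "set_integrable lborel {t0..} (\<lambda>t. (norm (u t))\<^sup>2)"
  proof (rule integrable[where k = "\<gamma> - 1 / \<delta>"])
    show "continuous_on {t0..} (\<lambda>t. (norm (u t))\<^sup>2)"
      by (intro continuous_intros cont)
    show "D t \<le> - ((\<gamma> - 1 / \<delta>) * (norm (u t))\<^sup>2)" if "t0 \<le> t" for t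
      using D[OF that] dissipation_nonneg(1,2)[OF that, of "x t"] dissipation_nonneg(3)[OF that, of "u t"] by linarith
  qed (use \<gamma> in auto)
  have gap_le: "gap (x t) \<le> ?C * (1 / \<beta> t)" if "t0 \<le> t" for t
    using E_ge(1)[of "\<beta> t" "x t" "l t" "u t"] E0[OF that] \<beta>_pos[OF that]
    by (simp add: pos_le_divide_eq mult.commute)
  show "(\<lambda>t. lagrangian f A b (x t) ls - f xs) \<in> O[at_top](\<lambda>t. 1 / \<beta> t)"
  proof (rule bigoI, rule eventually_at_top_linorderI)
    fix t assume t: "t0 \<le> t"
    show "norm (lagrangian f A b (x t) ls - f xs) \<le> ?C * norm (1 / \<beta> t)"
      using gap_le[OF t] gap_ge(1)[of "x t"] saddle_points_minimizer[OF saddle, of "x t"] \<beta>_pos[OF t]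
      by simp
  qed
  show "(\<lambda>t. norm (A *v x t - b)) \<in> O[at_top](\<lambda>t. 1 / sqrt (\<beta> t))"
  proof (rule bigoI, rule eventually_at_top_linorderI)
    fix t assume t: "t0 \<le> t"
    \<comment> \<open>The penalty is part of the gap and inherits its rate; the square root halves
      the exponent.\<close>
    have "\<sigma> / 2 * (norm (A *v x t - b))\<^sup>2 \<le> ?C * (1 / \<beta> t)"
      using gap_ge(2)[of "x t"] gap_le[OF t] by linarith
    from mult_left_mono[OF this, of "2 / \<sigma>"] \<sigma>
    have "(norm (A *v x t - b))\<^sup>2 \<le> 2 * ?C / \<sigma> * (1 / \<beta> t)"
      by simp
    then have "norm (A *v x t - b) \<le> sqrt (2 * ?C / \<sigma> * (1 / \<beta> t))"
      by (rule real_le_rsqrt)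
    also have "\<dots> = sqrt (2 * ?C / \<sigma>) * norm (1 / sqrt (\<beta> t))"
      using \<beta>_pos[OF t] by (simp add: real_sqrt_mult real_sqrt_divide)
    finally show "norm (norm (A *v x t - b)) \<le> sqrt (2 * ?C / \<sigma>) * norm (1 / sqrt (\<beta> t))"
      by simp
  qed
qed

text \<open>Existence is transferred from the truncated problem. Conversely, every solution of the
  original problem is confined and bounded, hence is a bounded solution of the truncated one, where
  uniqueness is known.\<close>

lemma flow_solution_exists_unique:
  assumes "locally_lipschitz (gradient f)"
  shows "\<exists>x l u. flow_solution t0 \<gamma> \<delta> \<sigma> \<beta> (gradient f) A b x0 l0 u0 x l u \<and>
    (\<forall>y m v. flow_solution t0 \<gamma> \<delta> \<sigma> \<beta> (gradient f) A b x0 l0 u0 y m v \<longrightarrow>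
       (\<forall>t\<ge>t0. y t = x t \<and> m t = l t))"
proof -
  obtain B where B: "0 \<le> B"
    "\<And>c x l u. 0 \<le> c \<Longrightarrow> E c x l u \<le> E (\<beta> t0) x0 l0 u0 \<Longrightarrow> norm x \<le> B \<and> norm l \<le> B \<and> norm u \<le> B"
    using E_sublevel_bounded[of "E (\<beta> t0) x0 l0 u0"] by blast
  \<comment> \<open>Any radius strictly larger than \<open>B\<close> leaves room for the barrier
    argument.\<close>
  let ?S = "cball (0::real^'n) (B + 1)"
  let ?g = "\<lambda>x. gradient f (closest_point ?S x)"
  have g: "?g y = gradient f y" if "norm y \<le> B + 1" for y
    using that by (simp add: closest_point_self)
  obtain L where "L-lipschitz_on ?S (gradient f)"
    using locally_lipschitz_imp_lipschitz_on_compact[OF assms compact_cball] .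
  then have L: "L-lipschitz_on UNIV ?g"
    using B(1) by (intro lipschitz_on_closest_point_compose) auto
  \<comment> \<open>Symmetric in the two fields, because it is used in both directions: for
    existence and for uniqueness.\<close>
  have change: "flow_solution t0 \<gamma> \<delta> \<sigma> \<beta> h' A b x0 l0 u0 x l u"
    if fs: "flow_solution t0 \<gamma> \<delta> \<sigma> \<beta> h A b x0 l0 u0 x l u"
      and h: "\<And>y. norm y \<le> B + 1 \<Longrightarrow> h y = gradient f y" "\<And>y. norm y \<le> B + 1 \<Longrightarrow> h' y = gradient f y"
    for h h' x l u
  proof -
    have "h' (x t) = h (x t)" if "t0 \<le> t" for t
      using flow_solution_confined[OF fs B(2)[THEN conjunct1] _ h(1) that] h by (simp add: less_imp_le)
    then show ?thesis
      using fs by (simp add: flow_solution_def)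
  qed
  have "\<forall>t\<ge>t0. 0 \<le> \<beta> t" using \<beta>_pos less_imp_le by blast
  then obtain x l u where fs: "flow_solution t0 \<gamma> \<delta> \<sigma> \<beta> ?g A b x0 l0 u0 x l u"
    and uniq: "\<forall>y m v. flow_solution t0 \<gamma> \<delta> \<sigma> \<beta> ?g A b x0 l0 u0 y m v \<longrightarrow>
       bounded ((\<lambda>t. (y t, m t, v t)) ` {t0..}) \<longrightarrow> (\<forall>t\<ge>t0. y t = x t \<and> m t = l t)"
    using flow_solution_exists[OF L continuous_on_\<beta>] by blast
  show ?thesis
  proof (intro exI conjI allI impI)
    show "flow_solution t0 \<gamma> \<delta> \<sigma> \<beta> (gradient f) A b x0 l0 u0 x l u"
      by (rule change[OF fs g refl])
    fix y m v t
    assume "flow_solution t0 \<gamma> \<delta> \<sigma> \<beta> (gradient f) A b x0 l0 u0 y m v" "t0 \<le> t"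
    with uniq change[OF this(1) refl g] flow_solution_estimates(1)[OF this(1)]
    show "y t = x t" "m t = l t" by blast+
  qed
qed

end

section \<open>Well-posedness and asymptotic estimates\<close>

theorem mainTheorem1:
  fixes t0 \<gamma> \<delta> \<sigma> :: real
    and A :: "real^'n^'m" and b :: "real^'m"
    and f :: "real^'n \<Rightarrow> real" and \<beta> :: "real \<Rightarrow> real"
    and x0 u0 :: "real^'n" and l0 :: "real^'m"
  assumes "t0 \<ge> 0" and "\<gamma> > 0" and "\<delta> > 0" and "\<sigma> > 0"
    and "convex_on UNIV f" and "continuously_differentiable f"
    and "saddle_points f A b \<noteq> {}"
    and "locally_lipschitz (gradient f)"
    and "\<And>t. t \<ge> t0 \<Longrightarrow> \<beta> t > 0" and "C1_from t0 \<beta>"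
    and "\<And>t. t \<ge> t0 \<Longrightarrow> deriv_from t0 \<beta> t \<le> 1 / \<delta> * \<beta> t"
    and "1 / \<delta> < \<gamma>"
  shows "\<exists>x l. global_solution t0 \<gamma> \<delta> \<sigma> \<beta> f A b x0 l0 u0 x l \<and>
    (\<forall>y m. global_solution t0 \<gamma> \<delta> \<sigma> \<beta> f A b x0 l0 u0 y m \<longrightarrow>
       (\<forall>t\<ge>t0. y t = x t \<and> m t = l t)) \<and>
    bounded ((\<lambda>t. (x t, l t)) ` {t0..}) \<and>
    (\<forall>(xs, ls) \<in> saddle_points f A b.
       set_integrable lborel {t0..}
         (\<lambda>t. (1 / \<delta> * \<beta> t - deriv_from t0 \<beta> t) *
              (aug_lagrangian \<sigma> f A b (x t) ls - aug_lagrangian \<sigma> f A b xs (l t))) \<and>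
       set_integrable lborel {t0..} (\<lambda>t. \<beta> t * (norm (A *v x t - b))\<^sup>2) \<and>
       set_integrable lborel {t0..} (\<lambda>t. (norm (deriv_from t0 x t))\<^sup>2) \<and>
       (filterlim \<beta> at_top at_top \<longrightarrow>
          (\<lambda>t. lagrangian f A b (x t) ls - lagrangian f A b xs (l t))
             \<in> O[at_top](\<lambda>t. 1 / \<beta> t) \<and>
          (\<lambda>t. norm (A *v x t - b)) \<in> O[at_top](\<lambda>t. 1 / sqrt (\<beta> t))))"
proof -
  \<comment> \<open>One saddle point suffices to construct the solution; the same trajectory is
    later tested against every saddle point.\<close>
  have pdf: "primal_dual_flow t0 \<gamma> \<delta> \<sigma> A b f \<beta> xs ls" if "(xs, ls) \<in> saddle_points f A b" for xs ls
    using assms that by (intro primal_dual_flow.intro) auto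
  obtain xs ls where saddle: "(xs, ls) \<in> saddle_points f A b"
    using assms(7) by auto
  interpret primal_dual_flow t0 \<gamma> \<delta> \<sigma> A b f \<beta> xs ls
    by (rule pdf[OF saddle])
  obtain x l u where fs: "flow_solution t0 \<gamma> \<delta> \<sigma> \<beta> (gradient f) A b x0 l0 u0 x l u"
    and uniq: "\<forall>y m v. flow_solution t0 \<gamma> \<delta> \<sigma> \<beta> (gradient f) A b x0 l0 u0 y m v \<longrightarrow>
       (\<forall>t\<ge>t0. y t = x t \<and> m t = l t)"
    using flow_solution_exists_unique[OF assms(8)] by blast
  have "continuous_on UNIV (gradient f)"
    using assms(6) by (simp add: continuously_differentiable_def)
  note gs = flow_solution_imp_global_solution[OF fs this continuous_on_\<beta>]
  show ?thesis
  proof (intro exI[of _ x] exI[of _ l] conjI)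
    show "global_solution t0 \<gamma> \<delta> \<sigma> \<beta> f A b x0 l0 u0 x l" by (rule gs(1))
    show "\<forall>y m. global_solution t0 \<gamma> \<delta> \<sigma> \<beta> f A b x0 l0 u0 y m \<longrightarrow>
       (\<forall>t\<ge>t0. y t = x t \<and> m t = l t)"
      using uniq global_solution_imp_flow_solution by blast
    have "bounded_linear (\<lambda>z :: (real^'n) \<times> (real^'m) \<times> (real^'n). (fst z, fst (snd z)))"
      by (intro bounded_linear_Pair bounded_linear_fst bounded_linear_compose[OF bounded_linear_fst bounded_linear_snd])
    from bounded_linear_image[OF flow_solution_estimates(1)[OF fs] this]
    show "bounded ((\<lambda>t. (x t, l t)) ` {t0..})"
      by (simp add: image_image)
  next
    show "\<forall>(xs, ls) \<in> saddle_points f A b.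
       set_integrable lborel {t0..}
         (\<lambda>t. (1 / \<delta> * \<beta> t - deriv_from t0 \<beta> t) *
              (aug_lagrangian \<sigma> f A b (x t) ls - aug_lagrangian \<sigma> f A b xs (l t))) \<and>
       set_integrable lborel {t0..} (\<lambda>t. \<beta> t * (norm (A *v x t - b))\<^sup>2) \<and>
       set_integrable lborel {t0..} (\<lambda>t. (norm (deriv_from t0 x t))\<^sup>2) \<and>
       (filterlim \<beta> at_top at_top \<longrightarrow>
          (\<lambda>t. lagrangian f A b (x t) ls - lagrangian f A b xs (l t))
             \<in> O[at_top](\<lambda>t. 1 / \<beta> t) \<and>
          (\<lambda>t. norm (A *v x t - b)) \<in> O[at_top](\<lambda>t. 1 / sqrt (\<beta> t)))"
    proof (intro ballI, unfold split_paired_all prod.case)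
      fix xs ls assume saddle: "(xs, ls) \<in> saddle_points f A b"
      note est = primal_dual_flow.flow_solution_estimates[OF pdf[OF saddle] fs]
      \<comment> \<open>Feasibility removes the multiplier and the penalty at \<open>xs\<close>, so
        the primal-dual differences reduce to differences with \<open>f xs\<close>.\<close>
      have "lagrangian f A b xs m = f xs" "aug_lagrangian \<sigma> f A b xs m = f xs" for m
        using saddle_points_feasible[OF saddle] by (simp_all add: lagrangian_def aug_lagrangian_def)
      \<comment> \<open>The functions \<open>u\<close> and \<open>deriv_from t0 x\<close> are known
        to agree only on \<open>{t0..}\<close>, which is enough for an integral over that
        set.\<close>
      moreover have "set_integrable lborel {t0..} (\<lambda>t. (norm (deriv_from t0 x t))\<^sup>2)"
        using est(4) by (rule set_integrable_cong[OF refl refl, THEN iffD1, rotated]) (simp add: gs(2))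
      ultimately show "set_integrable lborel {t0..}
         (\<lambda>t. (1 / \<delta> * \<beta> t - deriv_from t0 \<beta> t) *
              (aug_lagrangian \<sigma> f A b (x t) ls - aug_lagrangian \<sigma> f A b xs (l t))) \<and>
       set_integrable lborel {t0..} (\<lambda>t. \<beta> t * (norm (A *v x t - b))\<^sup>2) \<and>
       set_integrable lborel {t0..} (\<lambda>t. (norm (deriv_from t0 x t))\<^sup>2) \<and>
       (filterlim \<beta> at_top at_top \<longrightarrow>
          (\<lambda>t. lagrangian f A b (x t) ls - lagrangian f A b xs (l t))
             \<in> O[at_top](\<lambda>t. 1 / \<beta> t) \<and>
          (\<lambda>t. norm (A *v x t - b)) \<in> O[at_top](\<lambda>t. 1 / sqrt (\<beta> t)))"
        using est by simp
    qed
  qed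
qed

end
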